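(* Up to isomorphism, the only minor minimal completely almost nonplanar (MMCAN) graph is $K_5-e$, the complete graph on five vertices with one edge deleted.
   Context: Graphs are finite, simple and undirected. A graph $H$ is a minor of $G$ if $H$ can be obtained by contracting edges in a subgraph of $G$ (after a contraction, doubled edges are replaced by a single edge so that the graph stays simple); a minor of $G$ is proper if it is not $G$ itself. A planar graph is completely almost nonplanar (CAN) if it is not complete and adding an edge between any pair of nonadjacent vertices yields a nonplanar graph. A graph is MMCAN (minor minimal CAN) if it is CAN and no proper minor of it is CAN. *)

theory Defs
  imports "HOL-Analysis.Analysis"
begin

datatype 'a graph = Graph (verts: "'a set") (edges: "'a set set")

definition simple_graph :: "'a graph \<Rightarrow> bool" where
  "simple_graph G \<longleftrightarrow> finite (verts G) \<and> (\<forall>e\<in>edges G. e \<subseteq> verts G \<and> card e = 2)"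

definition complete_graph :: "'a graph \<Rightarrow> bool" where
  "complete_graph G \<longleftrightarrow> (\<forall>u\<in>verts G. \<forall>v\<in>verts G. u \<noteq> v \<longrightarrow> {u, v} \<in> edges G)"

definition add_edge :: "'a graph \<Rightarrow> 'a \<Rightarrow> 'a \<Rightarrow> 'a graph" where
  "add_edge G u v = Graph (verts G) (insert {u, v} (edges G))"

definition graph_iso :: "'a graph \<Rightarrow> 'b graph \<Rightarrow> bool" where
  "graph_iso G H \<longleftrightarrow> (\<exists>f. bij_betw f (verts G) (verts H) \<and>
     (\<forall>u\<in>verts G. \<forall>v\<in>verts G. {u, v} \<in> edges G \<longleftrightarrow> {f u, f v} \<in> edges H))"

definition subgraph :: "'a graph \<Rightarrow> 'a graph \<Rightarrow> bool" where
  "subgraph H G \<longleftrightarrow> simple_graph H \<and> verts H \<subseteq> verts G \<and> edges H \<subseteq> edges G"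

text \<open>Contracting the edge \<open>{u, v}\<close>: the merged vertex keeps the label \<open>u\<close>. Doubled edges
  coincide because edges form a set; the condition on the cardinality removes the loop that
  \<open>{u, v}\<close> becomes.\<close>

definition contract :: "'a graph \<Rightarrow> 'a \<Rightarrow> 'a \<Rightarrow> 'a graph" where
  "contract G u v = Graph (verts G - {v})
     {e'. card e' = 2 \<and> (\<exists>e\<in>edges G. e' = (\<lambda>x. if x = v then u else x) ` e)}"

inductive contracts_to :: "'a graph \<Rightarrow> 'a graph \<Rightarrow> bool" where
  refl: "contracts_to G G"
| step: "contracts_to G H \<Longrightarrow> {u, v} \<in> edges H \<Longrightarrow> u \<noteq> v \<Longrightarrow> contracts_to G (contract H u v)"

definition minor :: "'b graph \<Rightarrow> 'a graph \<Rightarrow> bool" where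
  "minor H G \<longleftrightarrow> simple_graph H \<and>
     (\<exists>S K. subgraph S G \<and> contracts_to S K \<and> graph_iso H K)"

text \<open>Minors are taken up to isomorphism, so ``not \<open>G\<close> itself'' means not isomorphic to \<open>G\<close>.\<close>

definition proper_minor :: "'b graph \<Rightarrow> 'a graph \<Rightarrow> bool" where
  "proper_minor H G \<longleftrightarrow> minor H G \<and> \<not> graph_iso H G"

text \<open>A drawing in the Euclidean plane (represented by the type \<open>complex\<close>): vertices are distinct
  points, every edge is a simple arc joining its end vertices and passing through no other
  vertex, and two different edges meet only in common end vertices.\<close>

definition plane_drawing :: "'a graph \<Rightarrow> ('a \<Rightarrow> complex) \<Rightarrow> ('a set \<Rightarrow> real \<Rightarrow> complex) \<Rightarrow> bool" where
  "plane_drawing G p \<gamma> \<longleftrightarrow>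
     inj_on p (verts G) \<and>
     (\<forall>e\<in>edges G. arc (\<gamma> e) \<and> {pathstart (\<gamma> e), pathfinish (\<gamma> e)} = p ` e) \<and>
     (\<forall>e\<in>edges G. path_image (\<gamma> e) \<inter> p ` verts G \<subseteq> p ` e) \<and>
     (\<forall>e\<in>edges G. \<forall>e'\<in>edges G. e \<noteq> e' \<longrightarrow>
        path_image (\<gamma> e) \<inter> path_image (\<gamma> e') \<subseteq> p ` (e \<inter> e'))"

definition planar :: "'a graph \<Rightarrow> bool" where
  "planar G \<longleftrightarrow> (\<exists>p \<gamma>. plane_drawing G p \<gamma>)"

definition CAN :: "'a graph \<Rightarrow> bool" where
  "CAN G \<longleftrightarrow> planar G \<and> \<not> complete_graph G \<and>
     (\<forall>u\<in>verts G. \<forall>v\<in>verts G. u \<noteq> v \<and> {u, v} \<notin> edges G \<longrightarrow> \<not> planar (add_edge G u v))"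

text \<open>It suffices to quantify over minors whose vertices have the same type as those of \<open>G\<close>:
  by the labelling convention of \<^const>\<open>contract\<close>, every minor of \<open>G\<close> is isomorphic to one with
  vertex set contained in that of \<open>G\<close>.\<close>

definition MMCAN :: "'a graph \<Rightarrow> bool" where
  "MMCAN G \<longleftrightarrow> CAN G \<and> (\<forall>H :: 'a graph. proper_minor H G \<longrightarrow> \<not> CAN H)"

definition K5_minus_edge :: "nat graph" where
  "K5_minus_edge = Graph {..<5} ({{u, v} |u v. u < 5 \<and> v < 5 \<and> u \<noteq> v} - {{0, 1}})"

end

theory Submission
  imports Defs
begin

text \<open>Redraw a plane graph so that its edges end in straight radii at the vertices. Then two vertices
  in the closure of one face can be joined inside that face, so in a CAN graph \<open>G\<close> they are adjacent.
  If removing \<open>S\<close> disconnects \<open>G\<close>, then \<open>G[S]\<close> contains a cycle: by Janiszewski's theorem the drawing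
  of a forest does not separate the plane, so there would be a path off \<open>G[S]\<close> from one part of
  \<open>G - S\<close> to another, running at some moment through a face that touches both parts.

  Let \<open>x\<close> and \<open>y\<close> be nonadjacent in \<open>G\<close>, let \<open>D\<close> be the component of \<open>y\<close> in \<open>G - N[x]\<close>, and let \<open>S\<close> be
  the set of neighbours of \<open>D\<close>. Then \<open>S\<close> consists of neighbours of \<open>x\<close> and contains the vertices of a
  cycle. Contracting \<open>D\<close> to a vertex and the cycle to a triangle gives \<open>K\<^sub>5 - e\<close>. Conversely, \<open>K\<^sub>5\<close> is
  not planar, every graph with at most four vertices is planar, and a subgraph of \<open>K\<^sub>5 - e\<close> on five
  vertices that lacks a further edge stays planar when that edge is restored.\<close>

subsection \<open>Arcs and faces\<close>

text \<open>A face is only a component of the complement of the drawing, so two topological facts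
  have to link it to the graph. Along an edge, contact of the closure of a face with one inner point
  spreads to the whole edge, hence to its ends. At a vertex, lying in the closure of a face does not
  immediately give a curve in that face ending there; this is the obstacle that the radial ends
  remove.

  The set \<open>S\<close> behaves as claimed because \<open>D\<close> is a whole component: a
  neighbour of \<open>D\<close> outside \<open>D\<close> that was not adjacent to \<open>x\<close>
  would belong to \<open>D\<close> itself. So each vertex of \<open>S\<close> is adjacent both to
  \<open>x\<close> and to some vertex of \<open>D\<close>. Hence the length of the cycle and its
  chords are irrelevant: however it is contracted to a triangle, all three corners are joined to
  \<open>x\<close> and to the contracted \<open>D\<close>, while these two stay nonadjacent because
  \<open>D\<close> avoids all neighbours of \<open>x\<close>.\<close>

text \<open>Fixing the last time \<open>s\<close> in \<open>S\<close> before searching for the first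
  later time \<open>t\<close> in \<open>T\<close> keeps both exclusions valid between them. It
  serves for the two end balls of an edge and for the two sides of a separator.\<close>

lemma last_exit_first_entry:
  fixes c :: "real \<Rightarrow> 'a::t2_space"
  assumes cont: "continuous_on {0..1} c"
    and cl: "closed S" "closed T"
    and ends: "c 0 \<in> S" "c 1 \<in> T"
    and disj: "\<And>t. t \<in> {0..1} \<Longrightarrow> c t \<notin> S \<inter> T"
  obtains s t where "0 \<le> s" "s < t" "t \<le> 1" "c s \<in> S" "c t \<in> T"
    "\<And>r. s < r \<Longrightarrow> r \<le> 1 \<Longrightarrow> c r \<notin> S" "\<And>r. s \<le> r \<Longrightarrow> r < t \<Longrightarrow> c r \<notin> T"
proof -
  have "compact ({0..1} \<inter> c -` S)"
    using continuous_closed_preimage[OF cont _ cl(1)] by (simp add: compact_eq_bounded_closed bounded_Int)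
  moreover have "{0..1} \<inter> c -` S \<noteq> {}" using ends by force
  ultimately obtain s where s: "s \<in> {0..1} \<inter> c -` S" "\<And>r. r \<in> {0..1} \<inter> c -` S \<Longrightarrow> r \<le> s"
    using compact_attains_sup by meson
  have "continuous_on {s..1} c" by (rule continuous_on_subset[OF cont]) (use s in auto)
  then have "compact ({s..1} \<inter> c -` T)"
    using continuous_closed_preimage[OF _ _ cl(2), of "{s..1}" c]
    by (simp add: compact_eq_bounded_closed bounded_Int)
  moreover have "{s..1} \<inter> c -` T \<noteq> {}" using ends s by force
  ultimately obtain t where t: "t \<in> {s..1} \<inter> c -` T" "\<And>r. r \<in> {s..1} \<inter> c -` T \<Longrightarrow> t \<le> r"
    using compact_attains_inf by meson
  have "s \<noteq> t" using s t disj[of s] by auto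
  show ?thesis
  proof (rule that[of s t])
    show "c r \<notin> S" if "s < r" "r \<le> 1" for r using s(1) s(2)[of r] that by auto
    show "c r \<notin> T" if "s \<le> r" "r < t" for r using t(1) t(2)[of r] that by force
  qed (use s t \<open>s \<noteq> t\<close> in auto)
qed

text \<open>If \<open>F\<close> missed an inner piece of the arc, it would also be a face after deleting that piece.
  The two remaining stumps separate nothing, by Janiszewski's theorem, so that face would contain
  the deleted piece.\<close>

lemma arc_subset_closure_face:
  fixes g :: "real \<Rightarrow> complex"
  assumes K: "compact K" and g: "arc g"
    and meet: "path_image g \<inter> K \<subseteq> {pathstart g, pathfinish g}"
    and F: "F \<in> components (- (K \<union> path_image g))"
    and t: "0 < t" "t < 1" "g t \<in> closure F"
  shows "path_image g \<subseteq> closure F"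
proof (rule ccontr)
  assume neg: "\<not> path_image g \<subseteq> closure F"
  have contg: "continuous_on {0..1} g" and inj: "inj_on g {0..1}"
    using g by (auto simp: arc_def path_def)
  have inner: "g r \<notin> K" if "0 < r" "r < 1" for r
  proof
    assume "g r \<in> K"
    moreover have "g r \<in> path_image g" using that by (simp add: path_image_def)
    ultimately have "g r \<in> {g 0, g 1}" using meet by (auto simp: pathstart_def pathfinish_def)
    then show False using inj_onD[OF inj, of r 0] inj_onD[OF inj, of r 1] that by auto
  qed
  \<comment> \<open>The ends of the arc are limits of inner points, so if all inner points were in
    the closed set \<open>closure F\<close>, the ends would be too.\<close>
  have "\<exists>s. 0 < s \<and> s < 1 \<and> g s \<notin> closure F"
  proof (rule ccontr)
    assume "\<not> ?thesis"
    then have "g ` {0<..<1} \<subseteq> closure F" by auto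
    moreover have "continuous_on (closure {0<..<1}) g" using contg by simp
    ultimately have "g ` closure {0<..<1} \<subseteq> closure F"
      by (intro image_closure_subset) auto
    then show False using neg by (simp add: path_image_def)
  qed
  then obtain s where s: "0 < s" "s < 1" "g s \<notin> closure F" by blast
  have "open (- closure F)" by (intro open_Compl closed_closure)
  then obtain \<epsilon> where \<epsilon>: "\<epsilon> > 0" "ball (g s) \<epsilon> \<subseteq> - closure F"
    using s(3) open_contains_ball by blast
  then obtain d where d: "d > 0" "\<And>r. r \<in> {0..1} \<Longrightarrow> dist r s < d \<Longrightarrow> dist (g r) (g s) < \<epsilon>"
    using contg s unfolding continuous_on_iff by (metis atLeastAtMost_iff less_eq_real_def)
  then have d: "d > 0" "\<And>r. r \<in> {0..1} \<Longrightarrow> dist r s < d \<Longrightarrow> g r \<notin> closure F"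
    using \<epsilon> by (auto simp: dist_commute subset_iff)
  \<comment> \<open>Small enough that the piece strictly between \<open>s - h\<close> and
    \<open>s + h\<close> misses \<open>closure F\<close> and that both stumps are nondegenerate
    arcs.\<close>
  define h where "h = min (d/2) (min (s/2) ((1-s)/2))"
  have h: "0 < h" "h < d" "h < s" "s + h < 1"
    using d(1) s by (auto simp: h_def min_def field_simps)
  define e1 where "e1 = subpath 0 (s-h) g"
  define e2 where "e2 = subpath (s+h) 1 g"
  have arcs: "arc e1" "arc e2" using g h s by (auto simp: e1_def e2_def intro!: arc_subpath_arc)
  have im: "path_image e1 = g ` {0..s-h}" "path_image e2 = g ` {s+h..1}"
    using h s by (auto simp: e1_def e2_def path_image_subpath)
  have int1: "connected (K \<inter> path_image e1)"
  proof -
    have "q = 0" if "q \<in> {0..s-h}" "g q \<in> K" for q using inner[of q] that h s by force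
    then have "K \<inter> path_image e1 \<subseteq> {g 0}" unfolding im by blast
    then show ?thesis by (metis connected_empty connected_sing subset_singletonD)
  qed
  have int2: "connected ((K \<union> path_image e1) \<inter> path_image e2)"
  proof -
    have "g a \<noteq> g b" if "a \<in> {0..s-h}" "b \<in> {s+h..1}" for a b
      using inj_onD[OF inj, of a b] that h s by auto
    moreover have last: "q = 1" if "q \<in> {s+h..1}" "g q \<in> K" for q using inner[of q] that h s by force
    ultimately have "(K \<union> path_image e1) \<inter> path_image e2 \<subseteq> {g 1}"
      unfolding im using last by blast
    then show ?thesis by (metis connected_empty connected_sing subset_singletonD)
  qed
  have sub: "K \<union> path_image e1 \<union> path_image e2 \<subseteq> K \<union> path_image g"
    using h s unfolding im unfolding path_image_def by auto
  have closedX: "closed (K \<union> path_image g)"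
    using K g by (simp add: arc_imp_path closed_Un closed_path_image compact_imp_closed)
  have "open (- K)" using K by (simp add: compact_imp_closed open_Compl)
  moreover have "g t \<in> - K" using inner t by auto
  ultimately obtain r where r: "r > 0" "ball (g t) r \<subseteq> - K" using open_contains_ball by blast
  obtain q where q: "q \<in> F" "q \<in> ball (g t) r"
    using t(3) r(1) by (auto simp: closure_approachable dist_commute)
  have qX: "q \<notin> K \<union> path_image g" using q F in_components_subset by fastforce
  have gs1: "g s \<notin> path_image e1" "g s \<notin> path_image e2"
    using inj s h by (auto simp: im dest!: inj_onD)
  \<comment> \<open>With the whole arc removed from the obstacle: go from \<open>q\<close> to
    \<open>g t\<close> in a ball that misses \<open>K\<close>, then along the inside of the arc. The
    stumps are put back one at a time.\<close>
  have cK: "connected_component (-K) q (g s)"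
  proof -
    have "connected_component (-K) q (g t)"
      unfolding connected_component_def using q r by (intro exI[of _ "ball (g t) r"]) auto
    moreover have "connected_component (-K) (g t) (g s)"
      unfolding connected_component_def
    proof (intro exI[of _ "g ` {0<..<1}"] conjI)
      show "connected (g ` {0<..<1})"
        by (rule connected_continuous_image) (auto intro: continuous_on_subset[OF contg])
    qed (use inner t s in auto)
    ultimately show ?thesis using connected_component_trans by blast
  qed
  have "connected_component (- path_image e1) q (g s)"
    using connected_arc_complement[OF arcs(1)] qX gs1 sub
    by (auto simp: connected_iff_connected_component)
  then have c1: "connected_component (- (K \<union> path_image e1)) q (g s)"
    using Janiszewski[OF K _ int1 cK] arcs by (simp add: closed_arc_image)
  have "connected_component (- path_image e2) q (g s)"
    using connected_arc_complement[OF arcs(2)] qX gs1 sub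
    by (auto simp: connected_iff_connected_component)
  then have c2: "connected_component (- (K \<union> path_image e1 \<union> path_image e2)) q (g s)"
    using Janiszewski[OF _ _ int2 c1] arcs K by (simp add: closed_arc_image compact_Un compact_arc_image)
  then obtain C where C: "connected C" "C \<subseteq> - (K \<union> path_image e1 \<union> path_image e2)" "q \<in> C" "g s \<in> C"
    unfolding connected_component_def by auto
  have "g s \<notin> F" using s closure_subset by blast
  then have "C \<inter> frontier F \<noteq> {}"
    using connected_Int_frontier[OF C(1)] q C by blast
  then obtain y where y: "y \<in> C" "y \<in> frontier F" by blast
  have "y \<in> K \<union> path_image g"
    using frontier_of_components_closed_complement[OF closedX F] y by blast
  then have "y \<in> g ` {0..1}" "y \<notin> g ` {0..s-h}" "y \<notin> g ` {s+h..1}"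
    using C(2) y(1) im by (auto simp: path_image_def[of g])
  then obtain b where b: "b \<in> {0..1}" "y = g b" "s - h < b" "b < s + h"
    by (smt (verit) atLeastAtMost_iff image_iff)
  then have "dist b s < d" using h by (auto simp: dist_real_def)
  then show False using d(2)[OF b(1)] y(2) b(2) by (simp add: frontier_def)
qed

subsection \<open>Radial drawings\<close>

text \<open>Between its last exit from the ball at \<open>a\<close> and its next entry into the ball
  at \<open>b\<close>, the arc touches each closed ball in a single point of the sphere. Straight
  radii glued on there cannot cross this middle part \<open>M\<close>.\<close>

lemma arc_with_radial_ends:
  fixes g :: "real \<Rightarrow> 'a::euclidean_space"
  assumes g: "arc g" "pathstart g = a" "pathfinish g = b" and r: "0 < r"
    and disj: "cball a r \<inter> cball b r = {}"
  obtains h M x y where "arc h" "pathstart h = a" "pathfinish h = b"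
    "path_image h = M \<union> (closed_segment a x \<union> closed_segment b y)" "M \<subseteq> path_image g"
    "dist a x = r" "dist b y = r" "M \<inter> cball a r = {x}" "M \<inter> cball b r = {y}"
proof -
  have contg: "continuous_on {0..1} g" using g by (auto simp: arc_def path_def)
  have "g 0 \<in> cball a r" "g 1 \<in> cball b r" using g r by (auto simp: pathstart_def pathfinish_def)
  then obtain s t where st: "0 \<le> s" "s < t" "t \<le> 1" "g s \<in> cball a r" "g t \<in> cball b r"
    "\<And>q. s < q \<Longrightarrow> q \<le> 1 \<Longrightarrow> g q \<notin> cball a r" "\<And>q. s \<le> q \<Longrightarrow> q < t \<Longrightarrow> g q \<notin> cball b r"
    by (rule last_exit_first_entry[OF contg closed_cball closed_cball]) (use disj in auto)
  \<comment> \<open>If \<open>g s\<close> were inside the sphere, the arc, which is outside at time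
    \<open>t\<close>, would cross the sphere after \<open>s\<close>.\<close>
  have da: "dist a (g s) = r"
  proof (rule ccontr)
    assume "dist a (g s) \<noteq> r"
    moreover have "continuous_on {s..t} (\<lambda>q. dist a (g q))"
      by (intro continuous_intros continuous_on_subset[OF contg]) (use st in auto)
    ultimately obtain q where "s \<le> q" "q \<le> t" "dist a (g q) = r"
      using IVT'[of "\<lambda>q. dist a (g q)" s r t] st(2-4) st(6)[of t] by force
    moreover then have "q \<noteq> s" using \<open>dist a (g s) \<noteq> r\<close> by auto
    ultimately show False using st(6)[of q] st(3) by auto
  qed
  have db: "dist b (g t) = r"
  proof (rule ccontr)
    assume "dist b (g t) \<noteq> r"
    moreover have "continuous_on {s..t} (\<lambda>q. dist b (g q))"
      by (intro continuous_intros continuous_on_subset[OF contg]) (use st in auto)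
    ultimately obtain q where "s \<le> q" "q \<le> t" "dist b (g q) = r"
      using IVT2'[of "\<lambda>q. dist b (g q)" t r s] st(2,5) st(7)[of s] by force
    moreover then have "q \<noteq> t" using \<open>dist b (g t) \<noteq> r\<close> by auto
    ultimately show False using st(7)[of q] by auto
  qed
  define M where "M = path_image (subpath s t g)"
  have M: "M = g ` {s..t}" using st by (simp add: M_def path_image_subpath)
  have Ma: "M \<inter> cball a r = {g s}"
  proof -
    have "q = s" if "q \<in> {s..t}" "g q \<in> cball a r" for q
      using st(3) st(6)[of q] that by (cases "s = q") auto
    then show ?thesis using st(2,4) unfolding M by fastforce
  qed
  have Mb: "M \<inter> cball b r = {g t}"
  proof -
    have "q = t" if "q \<in> {s..t}" "g q \<in> cball b r" for q
      using st(7)[of q] that by (cases "q = t") auto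
    then show ?thesis using st(2,5) unfolding M by fastforce
  qed
  have segs: "closed_segment a (g s) \<subseteq> cball a r" "closed_segment (g t) b \<subseteq> cball b r"
    by (rule closed_segment_subset[OF _ _ convex_cball]; use da db r in simp)+
  define h where "h = linepath a (g s) +++ (subpath s t g +++ linepath (g t) b)"
  have "arc (subpath s t g)" using st g by (auto intro!: arc_subpath_arc)
  then have 1: "arc (subpath s t g +++ linepath (g t) b)"
    by (rule arc_join) (use db r segs Mb in \<open>auto simp flip: M_def\<close>)
  have 2: "path_image (subpath s t g +++ linepath (g t) b) = M \<union> closed_segment (g t) b"
    by (simp add: path_image_join M_def)
  have "arc h" unfolding h_def
    by (rule arc_join[OF _ 1]) (use da r segs Ma disj in \<open>auto simp: 2\<close>)
  moreover have "path_image h = M \<union> (closed_segment a (g s) \<union> closed_segment b (g t))"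
    unfolding h_def by (subst path_image_join) (auto simp: 2 closed_segment_commute)
  moreover have "M \<subseteq> path_image g" using st M by (auto simp: path_image_def)
  ultimately show ?thesis using da db Ma Mb by (intro that[of h M "g s" "g t"]) (auto simp: h_def)
qed

definition drawn :: "('a \<Rightarrow> complex) \<Rightarrow> ('a set \<Rightarrow> real \<Rightarrow> complex) \<Rightarrow> 'a graph \<Rightarrow> complex set" where
  "drawn p \<gamma> G = p ` verts G \<union> (\<Union>e\<in>edges G. path_image (\<gamma> e))"

text \<open>Near \<open>c\<close> the set is a cone with apex \<open>c\<close>. Invariance under
  scaling speaks of the point set alone, so it treats vertices of any degree alike, isolated ones
  included, and passes directly to the complement.\<close>

definition conical :: "'a::real_normed_vector set \<Rightarrow> 'a \<Rightarrow> bool" where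
  "conical X c \<longleftrightarrow> (\<exists>r>0. \<forall>z\<in>X \<inter> ball c r. \<forall>t>0.
     c + t *\<^sub>R (z - c) \<in> ball c r \<longrightarrow> c + t *\<^sub>R (z - c) \<in> X)"

definition radial_drawing :: "'a graph \<Rightarrow> ('a \<Rightarrow> complex) \<Rightarrow> ('a set \<Rightarrow> real \<Rightarrow> complex) \<Rightarrow> bool" where
  "radial_drawing G p \<gamma> \<longleftrightarrow> plane_drawing G p \<gamma> \<and> (\<forall>v\<in>verts G. conical (drawn p \<gamma> G) (p v))"

lemma plane_drawing_vertex_on_edge:
  assumes "plane_drawing G p \<gamma>" "e \<in> edges G"
  shows "path_image (\<gamma> e) \<inter> p ` verts G \<subseteq> p ` e"
  using assms unfolding plane_drawing_def by simp

lemma finite_edges: "simple_graph G \<Longrightarrow> finite (edges G)"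
  unfolding simple_graph_def by (meson Pow_iff finite_Pow_iff finite_subset subsetI)

lemma eventually_cball_disjoint_closed:
  fixes c :: "'a::{metric_space, heine_borel}"
  assumes "closed K" "c \<notin> K"
  shows "\<forall>\<^sub>F r in at_right 0. cball c r \<inter> K = {}"
proof -
  have "open (- K)" "c \<in> - K" using assms by auto
  then obtain d where d: "d > 0" "cball c d \<subseteq> - K" using open_contains_cball by blast
  have "cball c r \<inter> K = {}" if "r < d" for r
    using d(2) subset_cball[of r d c] that by auto
  then show ?thesis unfolding eventually_at_right_field using d(1) by blast
qed

lemma eventually_cballs_disjoint:
  fixes c :: "'a::metric_space"
  assumes "c \<noteq> c'"
  shows "\<forall>\<^sub>F r in at_right 0. cball c r \<inter> cball c' r = {}"
proof -
  have "cball c r \<inter> cball c' r = {}" if "r < dist c c' / 2" for r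
  proof (rule ccontr)
    assume "cball c r \<inter> cball c' r \<noteq> {}"
    then obtain z where "dist c z \<le> r" "dist c' z \<le> r" by auto
    then show False using dist_triangle2[of c c' z] that by linarith
  qed
  then show ?thesis unfolding eventually_at_right_field
    using assms by (intro exI[of _ "dist c c' / 2"]) auto
qed

text \<open>Each of finitely many requirements holds for all sufficiently small radii, so one radius
  meets them all.\<close>

lemma exists_separating_radius:
  assumes G: "simple_graph G" and d: "plane_drawing G p \<gamma>"
  obtains r where "0 < r"
    "\<And>v w. v \<in> verts G \<Longrightarrow> w \<in> verts G \<Longrightarrow> v \<noteq> w \<Longrightarrow> cball (p v) r \<inter> cball (p w) r = {}"
    "\<And>v e. v \<in> verts G \<Longrightarrow> e \<in> edges G \<Longrightarrow> v \<notin> e \<Longrightarrow> cball (p v) r \<inter> path_image (\<gamma> e) = {}"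
proof -
  have fin: "finite (verts G)" "finite (edges G)" using G finite_edges by (auto simp: simple_graph_def)
  have inj: "inj_on p (verts G)" using d by (simp add: plane_drawing_def)
  have "\<forall>\<^sub>F r in at_right 0. v \<noteq> w \<longrightarrow> cball (p v) r \<inter> cball (p w) r = {}"
    if "v \<in> verts G" "w \<in> verts G" for v w
    using eventually_cballs_disjoint[of "p v" "p w"] inj_onD[OF inj, of v w] that
    by (cases "v = w") auto
  then have 1: "\<forall>\<^sub>F r in at_right 0. \<forall>v\<in>verts G. \<forall>w\<in>verts G. v \<noteq> w \<longrightarrow> cball (p v) r \<inter> cball (p w) r = {}"
    using fin by (intro eventually_ball_finite ballI) blast+
  have "\<forall>\<^sub>F r in at_right 0. v \<notin> e \<longrightarrow> cball (p v) r \<inter> path_image (\<gamma> e) = {}"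
    if "v \<in> verts G" "e \<in> edges G" for v e
  proof (cases "v \<in> e")
    case False
    have "e \<subseteq> verts G" using G that by (auto simp: simple_graph_def)
    then have "p v \<notin> p ` e" using False inj that by (auto dest: inj_onD)
    then have "p v \<notin> path_image (\<gamma> e)" using d that unfolding plane_drawing_def by blast
    moreover have "closed (path_image (\<gamma> e))"
      using d that by (auto simp: plane_drawing_def closed_arc_image)
    ultimately show ?thesis using eventually_cball_disjoint_closed eventually_mono by fastforce
  qed auto
  then have 2: "\<forall>\<^sub>F r in at_right 0. \<forall>v\<in>verts G. \<forall>e\<in>edges G. v \<notin> e \<longrightarrow> cball (p v) r \<inter> path_image (\<gamma> e) = {}"
    using fin by (intro eventually_ball_finite ballI) blast+
  obtain b where b: "b > (0::real)"
    "\<And>r. 0 < r \<Longrightarrow> r < b \<Longrightarrow> (\<forall>v\<in>verts G. \<forall>w\<in>verts G. v \<noteq> w \<longrightarrow> cball (p v) r \<inter> cball (p w) r = {}) \<and>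
      (\<forall>v\<in>verts G. \<forall>e\<in>edges G. v \<notin> e \<longrightarrow> cball (p v) r \<inter> path_image (\<gamma> e) = {})"
    using eventually_conj[OF 1 2] unfolding eventually_at_right_field by blast
  show ?thesis using b(1) b(2)[of "b/2"] by (intro that[of "b/2"]) auto
qed

text \<open>A common point off the centre determines the direction of a radius, and the length then
  determines its tip. This keeps radii of different edges apart.\<close>

lemma closed_segment_dist_eq:
  fixes a :: "'a::real_normed_vector"
  assumes "z \<in> closed_segment a x" "z \<in> closed_segment a y" "dist a x = dist a y" "z \<noteq> a"
  shows "x = y"
proof -
  obtain k where k: "0 \<le> k" "z = a + k *\<^sub>R (x - a)"
    using assms(1) by (auto simp: in_segment algebra_simps)
  obtain l where l: "0 \<le> l" "z = a + l *\<^sub>R (y - a)"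
    using assms(2) by (auto simp: in_segment algebra_simps)
  have eq: "k *\<^sub>R (x - a) = l *\<^sub>R (y - a)" using k l by simp
  then have "k * norm (x - a) = l * norm (y - a)"
    using k l by (metis abs_of_nonneg norm_scaleR)
  moreover have "norm (x - a) = norm (y - a)" using assms(3) by (simp add: dist_norm norm_minus_commute)
  moreover have "norm (x - a) \<noteq> 0" "k \<noteq> 0" using k assms(4) by auto
  ultimately show ?thesis using eq by auto
qed

text \<open>Radial ends make every vertex in the closure of a face accessible from that face along a
  straight segment, although the arcs of the given drawing may be wild near their ends.\<close>

lemma planar_imp_radial_drawing:
  assumes G: "simple_graph G" and "planar G"
  obtains p \<gamma> where "radial_drawing G p \<gamma>"
proof -
  obtain p \<gamma> where d: "plane_drawing G p \<gamma>" using \<open>planar G\<close> by (auto simp: planar_def)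
  note dd = d[unfolded plane_drawing_def]
  obtain r where r: "0 < r"
    and balls: "\<And>v w. v \<in> verts G \<Longrightarrow> w \<in> verts G \<Longrightarrow> v \<noteq> w \<Longrightarrow> cball (p v) r \<inter> cball (p w) r = {}"
    and far: "\<And>v e. v \<in> verts G \<Longrightarrow> e \<in> edges G \<Longrightarrow> v \<notin> e \<Longrightarrow> cball (p v) r \<inter> path_image (\<gamma> e) = {}"
    using exists_separating_radius[OF G d] by metis
  have same: "v = w" if "z \<in> cball (p v) r" "z \<in> cball (p w) r" "v \<in> verts G" "w \<in> verts G" for v w z
    using balls[of v w] that by blast
  \<comment> \<open>The data of one redrawn edge: \<open>h\<close> is the new arc, \<open>M\<close>
    its middle part kept from the old arc, and \<open>x v\<close> the tip of its radius at the end
    \<open>v\<close>. Indexing by the ends makes both ends symmetric.\<close>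
  define R where "R e h M x \<longleftrightarrow> arc h \<and> {pathstart h, pathfinish h} = p ` e \<and> M \<subseteq> path_image (\<gamma> e) \<and>
      path_image h = M \<union> (\<Union>v\<in>e. closed_segment (p v) (x v)) \<and>
      (\<forall>v\<in>e. dist (p v) (x v) = r \<and> M \<inter> cball (p v) r = {x v})" for e h M x
  have ex: "\<exists>h M x. R e h M x" if "e \<in> edges G" for e
  proof -
    have e: "e \<subseteq> verts G" "card e = 2" using G that by (auto simp: simple_graph_def)
    have arc: "arc (\<gamma> e)" and ends: "{pathstart (\<gamma> e), pathfinish (\<gamma> e)} = p ` e"
      using dd that by auto
    obtain u v where uv: "e = {u, v}" "p u = pathstart (\<gamma> e)" "p v = pathfinish (\<gamma> e)"
    proof -
      obtain a b where ab: "e = {a, b}" "a \<noteq> b" using e by (meson card_2_iff)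
      with ends have "{pathstart (\<gamma> e), pathfinish (\<gamma> e)} = {p a, p b}" by auto
      then show ?thesis using that[of a b] that[of b a] ab by (auto simp: doubleton_eq_iff)
    qed
    then have "u \<noteq> v" using e by auto
    then have bd: "cball (p u) r \<inter> cball (p v) r = {}" using balls[of u v] uv(1) e by blast
    obtain h M x y where h: "arc h" "pathstart h = p u" "pathfinish h = p v"
      "path_image h = M \<union> (closed_segment (p u) x \<union> closed_segment (p v) y)" "M \<subseteq> path_image (\<gamma> e)"
      "dist (p u) x = r" "dist (p v) y = r" "M \<inter> cball (p u) r = {x}" "M \<inter> cball (p v) r = {y}"
      by (rule arc_with_radial_ends[OF arc uv(2)[symmetric] uv(3)[symmetric] r bd])
    then show ?thesis using uv(1) \<open>u \<noteq> v\<close> unfolding R_def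
      by (intro exI[of _ h] exI[of _ M] exI[of _ "(\<lambda>w. y)(u := x)"]) auto
  qed
  then obtain h M x where "\<And>e. e \<in> edges G \<Longrightarrow> R e (h e) (M e) (x e)" by metis
  then have hM: "\<And>e. e \<in> edges G \<Longrightarrow> arc (h e) \<and> {pathstart (h e), pathfinish (h e)} = p ` e \<and>
      M e \<subseteq> path_image (\<gamma> e) \<and> path_image (h e) = M e \<union> (\<Union>v\<in>e. closed_segment (p v) (x e v)) \<and>
      (\<forall>v\<in>e. dist (p v) (x e v) = r \<and> M e \<inter> cball (p v) r = {x e v})"
    unfolding R_def by blast
  then have h_image: "\<And>e. e \<in> edges G \<Longrightarrow> path_image (h e) = M e \<union> (\<Union>v\<in>e. closed_segment (p v) (x e v))"
    by blast
  have in_verts: "v \<in> verts G" if "e \<in> edges G" "v \<in> e" for e v using G that by (auto simp: simple_graph_def)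
  have seg_ball: "closed_segment (p v) (x e v) \<subseteq> cball (p v) r" if "e \<in> edges G" "v \<in> e" for e v
    by (rule closed_segment_subset[OF _ _ convex_cball]; use hM that r in force)
  have x_in: "x e v \<in> path_image (\<gamma> e)" "dist (p v) (x e v) = r" if "e \<in> edges G" "v \<in> e" for e v
    using hM that by blast+
  have M_ball: "v \<in> e \<and> z = x e v" if "e \<in> edges G" "z \<in> M e" "z \<in> cball (p v) r" "v \<in> verts G" for e v z
    using hM[OF that(1)] far[of v e] that by blast
  have seg_sphere: "z = x e v" if "e \<in> edges G" "v \<in> e" "z \<in> closed_segment (p v) (x e v)" "dist (p v) z = r" for e v z
    using closed_segment_dist_eq[of z "p v" "x e v" z] that x_in(2)[of e v] r by auto
  have cross: "path_image (h e) \<inter> path_image (h e') \<subseteq> p ` (e \<inter> e')"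
    if e: "e \<in> edges G" "e' \<in> edges G" "e \<noteq> e'" for e e'
  proof
    have \<gamma>: "path_image (\<gamma> e) \<inter> path_image (\<gamma> e') \<subseteq> p ` (e \<inter> e')" using dd that by blast
    fix z assume z: "z \<in> path_image (h e) \<inter> path_image (h e')"
    \<comment> \<open>A middle part meets the ball only on the sphere, and a radius meets the sphere
      only at its tip. Such a \<open>z\<close> therefore lies on both old arcs.\<close>
    have mixed: "z \<in> p ` (a \<inter> b)"
      if "a \<in> edges G" "b \<in> edges G" "a \<noteq> b" "z \<in> M a" "v \<in> b" "z \<in> closed_segment (p v) (x b v)" for a b v
    proof -
      have "z \<in> cball (p v) r" using seg_ball that by blast
      then have "v \<in> a" "z = x a v" using M_ball[of a z v] that in_verts by auto
      then have "z = x b v" using seg_sphere[of b v z] that x_in(2)[of a v] by auto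
      then have "z \<in> path_image (\<gamma> a) \<inter> path_image (\<gamma> b)" using hM[of a] x_in[of b v] that by auto
      then show ?thesis using dd that by blast
    qed
    consider "z \<in> M e" "z \<in> M e'" | v where "z \<in> M e" "v \<in> e'" "z \<in> closed_segment (p v) (x e' v)"
      | v where "z \<in> M e'" "v \<in> e" "z \<in> closed_segment (p v) (x e v)"
      | v w where "v \<in> e" "z \<in> closed_segment (p v) (x e v)" "w \<in> e'" "z \<in> closed_segment (p w) (x e' w)"
      using z unfolding h_image[OF e(1)] h_image[OF e(2)] by blast
    then show "z \<in> p ` (e \<inter> e')"
    proof cases
      case 1
      then have "z \<in> path_image (\<gamma> e) \<inter> path_image (\<gamma> e')" using hM[OF e(1)] hM[OF e(2)] by auto
      then show ?thesis using \<gamma> by blast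
    next
      case 2 then show ?thesis using mixed[of e e'] e by auto
    next
      case 3 then show ?thesis using mixed[of e' e] e by (auto simp: Int_commute)
    next
      case 4
      then have "z \<in> cball (p v) r" "z \<in> cball (p w) r" using seg_ball e by blast+
      then have "v = w" using same in_verts e 4 by blast
      show ?thesis
      proof (cases "z = p v")
        case True then show ?thesis using 4 \<open>v = w\<close> by auto
      next
        case False
        \<comment> \<open>A common tip lies on both old arcs, so it is a vertex. The only vertex in
          the ball is the centre, which is not at distance \<open>r\<close> from itself.\<close>
        then have "x e v = x e' v"
          using closed_segment_dist_eq[of z "p v"] 4 \<open>v = w\<close> e x_in(2) by auto
        then have "x e v \<in> path_image (\<gamma> e) \<inter> path_image (\<gamma> e')"
          using 4 \<open>v = w\<close> e x_in(1)[of e v] x_in(1)[of e' v] by auto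
        then obtain u where u: "u \<in> e" "x e v = p u" using \<gamma> by auto
        then have "p u \<in> cball (p v) r" using x_in(2)[of e v] 4 e by auto
        then have "u = v" using same[of "p u" v u] in_verts[of e] u 4 e r by auto
        then show ?thesis using u x_in(2)[of e v] 4 e r by auto
      qed
    qed
  qed
  have verts: "path_image (h e) \<inter> p ` verts G \<subseteq> p ` e" if e: "e \<in> edges G" for e
  proof
    fix z assume z: "z \<in> path_image (h e) \<inter> p ` verts G"
    then obtain w where w: "w \<in> verts G" "z = p w" by auto
    from z consider "z \<in> M e" | v where "v \<in> e" "z \<in> closed_segment (p v) (x e v)"
      unfolding h_image[OF e] by blast
    then show "z \<in> p ` e"
    proof cases
      case 1
      moreover have "M e \<subseteq> path_image (\<gamma> e)" using hM[OF e] by simp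
      moreover have "path_image (\<gamma> e) \<inter> p ` verts G \<subseteq> p ` e" using dd e by simp
      ultimately show ?thesis using z by blast
    next
      case 2
      then have "w = v" using same[of z w v] seg_ball[OF e, of v] w in_verts[of e v] r e by auto
      then show ?thesis using 2 w by auto
    qed
  qed
  have "plane_drawing G p h" unfolding plane_drawing_def
  proof (intro conjI ballI impI)
    show "inj_on p (verts G)" using dd by blast
    fix e assume e: "e \<in> edges G"
    show "arc (h e)" "{pathstart (h e), pathfinish (h e)} = p ` e" using hM[OF e] by simp_all
    show "path_image (h e) \<inter> p ` verts G \<subseteq> p ` e" by (rule verts[OF e])
    fix e' assume "e' \<in> edges G" "e \<noteq> e'"
    then show "path_image (h e) \<inter> path_image (h e') \<subseteq> p ` (e \<inter> e')" using cross e by simp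
  qed
  moreover have "conical (drawn p h G) (p v)" if v: "v \<in> verts G" for v
    unfolding conical_def
  proof (intro exI[of _ r] conjI ballI allI impI)
    fix z t assume z: "z \<in> drawn p h G \<inter> ball (p v) r" and t: "(0::real) < t"
      and b: "p v + t *\<^sub>R (z - p v) \<in> ball (p v) r"
    have zc: "z \<in> cball (p v) r" using z by auto
    show "p v + t *\<^sub>R (z - p v) \<in> drawn p h G"
    proof (cases "z = p v")
      case True then show ?thesis using v by (auto simp: drawn_def)
    next
      case False
      have "z \<notin> p ` verts G"
      proof
        assume "z \<in> p ` verts G"
        then obtain w where w: "w \<in> verts G" "z = p w" by auto
        then show False using False same[OF zc _ v w(1)] r by auto
      qed
      then obtain e where e: "e \<in> edges G" "z \<in> path_image (h e)" using z by (auto simp: drawn_def)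
      \<comment> \<open>In the open ball only radii at \<open>v\<close> remain, because the middle
        parts reach the closed ball only on its sphere.\<close>
      have "z \<notin> M e" using M_ball[OF e(1) _ zc v] x_in(2)[OF e(1), of v] z by auto
      then obtain w where "w \<in> e" "z \<in> closed_segment (p w) (x e w)" using hM e by auto
      moreover then have "w = v" using same[OF _ zc _ v] seg_ball[OF e(1), of w] in_verts[OF e(1)] by auto
      ultimately have w: "v \<in> e" "z \<in> closed_segment (p v) (x e v)" by auto
      then obtain k where k: "0 \<le> k" "k \<le> 1" "z = p v + k *\<^sub>R (x e v - p v)"
        by (auto simp: in_segment algebra_simps)
      then have eq: "p v + t *\<^sub>R (z - p v) = p v + (t * k) *\<^sub>R (x e v - p v)" by simp
      have "dist (p v) (p v + (t * k) *\<^sub>R (x e v - p v)) = (t * k) * r"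
        using x_in(2)[OF e(1) w(1)] t k by (simp add: dist_norm norm_minus_commute)
      then have "t * k < 1" using b r unfolding eq by simp
      then have "p v + (t * k) *\<^sub>R (x e v - p v) \<in> closed_segment (p v) (x e v)"
        unfolding in_segment using t k
        by (intro exI[of _ "t * k"]) (auto simp: algebra_simps simp del: mult_less_cancel_right)
      then show ?thesis unfolding eq drawn_def using hM e w by blast
    qed
  qed (use r in auto)
  ultimately show ?thesis using that by (auto simp: radial_drawing_def)
qed

subsection \<open>Separators of completely almost nonplanar graphs\<close>

definition induced :: "'a graph \<Rightarrow> 'a set \<Rightarrow> 'a graph" where
  "induced G S = Graph S {e \<in> edges G. e \<subseteq> S}"

text \<open>This replaces cycles: a finite induced subgraph has a cycle exactly when some nonempty
  set of its vertices has this property. Its failure directly supplies the vertex of degree at most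
  one that an induction over forests removes.\<close>

definition min_degree_two :: "'a graph \<Rightarrow> 'a set \<Rightarrow> bool" where
  "min_degree_two G T \<longleftrightarrow>
     (\<forall>v\<in>T. \<exists>a\<in>T. \<exists>b\<in>T. a \<noteq> b \<and> {v, a} \<in> edges G \<and> {v, b} \<in> edges G)"

lemma edge_vertices:
  assumes "simple_graph G" "{u, v} \<in> edges G"
  shows "u \<noteq> v" "u \<in> verts G" "v \<in> verts G"
  using assms by (auto simp: simple_graph_def card_2_iff doubleton_eq_iff)

lemma edgeE:
  assumes "simple_graph G" "e \<in> edges G" "v \<in> e"
  obtains w where "e = {v, w}" "v \<noteq> w"
  using assms unfolding simple_graph_def card_2_iff by (metis insertE insert_commute singletonD)

lemma compact_drawn:
  assumes "plane_drawing G p \<gamma>" "edges H \<subseteq> edges G" "finite (verts H)" "finite (edges H)"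
  shows "compact (drawn p \<gamma> H)"
proof -
  have "compact (path_image (\<gamma> e))" if "e \<in> edges H" for e
    using assms that by (auto simp: plane_drawing_def intro: compact_arc_image)
  then show ?thesis unfolding drawn_def using assms
    by (intro compact_Un compact_UN finite_imp_compact[OF finite_imageI])
qed

text \<open>Take \<open>q\<close> in \<open>F\<close> close to \<open>c\<close>. If a point between
  \<open>c\<close> and \<open>q\<close> were in \<open>X\<close>, scaling it back out would put
  \<open>q\<close> in \<open>X\<close>. So the segment without \<open>c\<close> avoids
  \<open>X\<close> and stays in the component of \<open>q\<close>.\<close>

lemma conical_access:
  fixes X :: "'a::real_normed_vector set"
  assumes con: "conical X c" and F: "F \<in> components (- X)" and c: "c \<in> closure F"
  obtains q where "q \<in> F" "closed_segment c q \<subseteq> insert c F"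
proof -
  obtain r where r: "r > 0" and X: "\<And>z t. z \<in> X \<Longrightarrow> z \<in> ball c r \<Longrightarrow> 0 < t \<Longrightarrow>
     c + t *\<^sub>R (z - c) \<in> ball c r \<Longrightarrow> c + t *\<^sub>R (z - c) \<in> X"
    using con unfolding conical_def by blast
  obtain q where q: "q \<in> F" "q \<in> ball c r"
    using c r by (auto simp: closure_approachable dist_commute)
  define R where "R = (\<lambda>k. c + k *\<^sub>R (q - c)) ` {0<..1}"
  have "q \<notin> X" using q F in_components_subset by fastforce
  have "R \<subseteq> - X"
  proof
    fix z assume "z \<in> R"
    then obtain k where k: "0 < k" "k \<le> 1" "z = c + k *\<^sub>R (q - c)" by (auto simp: R_def)
    have "dist c z \<le> dist c q"
      using k by (simp add: dist_norm norm_minus_commute mult_left_le_one_le)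
    then have "z \<in> ball c r" using q by auto
    moreover have "c + (1/k) *\<^sub>R (z - c) = q" using k by simp
    ultimately show "z \<in> - X" using X[of z "1/k"] k q \<open>q \<notin> X\<close> by auto
  qed
  moreover have "connected R" unfolding R_def
    by (intro connected_continuous_image continuous_intros) auto
  moreover have "q \<in> R" unfolding R_def by (intro image_eqI[of _ _ 1]) auto
  ultimately have "R \<subseteq> F" using components_maximal[OF F] q by blast
  moreover have "closed_segment c q \<subseteq> insert c R"
  proof
    fix z assume "z \<in> closed_segment c q"
    then obtain k where "0 \<le> k" "k \<le> 1" "z = c + k *\<^sub>R (q - c)"
      by (auto simp: in_segment algebra_simps)
    then show "z \<in> insert c R" by (cases "k = 0") (auto simp: R_def)
  qed
  ultimately show ?thesis using that[of q] q by blast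
qed

text \<open>An open connected face is path connected, so the access segments at \<open>u\<close> and
  \<open>w\<close> can be linked inside it. The resulting path may cross itself; an arc contained in
  its image serves as the new edge.\<close>

lemma planar_add_edge_in_face:
  assumes G: "simple_graph G" and rad: "radial_drawing G p \<gamma>"
    and uw: "u \<in> verts G" "w \<in> verts G" "u \<noteq> w" "{u, w} \<notin> edges G"
    and F: "F \<in> components (- drawn p \<gamma> G)" and cl: "p u \<in> closure F" "p w \<in> closure F"
  shows "planar (add_edge G u w)"
proof -
  let ?X = "drawn p \<gamma> G"
  have d: "plane_drawing G p \<gamma>" and con: "conical ?X (p u)" "conical ?X (p w)"
    using rad uw by (auto simp: radial_drawing_def)
  have inj: "inj_on p (verts G)" using d by (simp add: plane_drawing_def)
  have ne: "p u \<noteq> p w" using inj uw by (auto dest: inj_onD)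
  have "compact ?X"
    using d G by (intro compact_drawn[where G=G]) (auto simp: finite_edges simple_graph_def)
  then have "open F" using F open_components compact_imp_closed by blast
  then have "path_connected F"
    using F connected_open_path_connected in_components_connected by blast
  obtain q where q: "q \<in> F" "closed_segment (p u) q \<subseteq> insert (p u) F"
    by (rule conical_access[OF con(1) F cl(1)])
  obtain q' where q': "q' \<in> F" "closed_segment (p w) q' \<subseteq> insert (p w) F"
    by (rule conical_access[OF con(2) F cl(2)])
  let ?T = "insert (p u) (insert (p w) F)"
  have "path_component ?T (p u) q" using q by (intro path_component_linepath) auto
  moreover have "path_component ?T q q'"
  proof (rule path_component_of_subset[of F])
    show "path_component F q q'"
      using \<open>path_connected F\<close> q(1) q'(1) by (simp add: path_connected_component)
  qed auto
  moreover have "path_component ?T q' (p w)"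
    using q' by (intro path_component_sym[OF path_component_linepath]) auto
  ultimately have "path_component ?T (p u) (p w)" using path_component_trans by blast
  then obtain g0 where g0: "path g0" "path_image g0 \<subseteq> ?T" "pathstart g0 = p u" "pathfinish g0 = p w"
    unfolding path_component_def by auto
  obtain g where g: "arc g" "path_image g \<subseteq> ?T" "pathstart g = p u" "pathfinish g = p w"
    using path_contains_arc[OF g0(1,3,4) ne] g0(2) by (metis subset_trans)
  have "F \<inter> ?X = {}" using F in_components_subset by blast
  then have gX: "path_image g \<inter> ?X \<subseteq> {p u, p w}" using g(2) by auto
  define \<gamma>' where "\<gamma>' = \<gamma>({u, w} := g)"
  have old: "\<gamma>' e = \<gamma> e" if "e \<in> edges G" for e using that uw by (auto simp: \<gamma>'_def)
  have new: "\<gamma>' {u, w} = g" by (simp add: \<gamma>'_def)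
  have cross: "path_image (\<gamma> e) \<inter> path_image g \<subseteq> p ` (e \<inter> {u, w})" if e: "e \<in> edges G" for e
  proof
    fix z assume z: "z \<in> path_image (\<gamma> e) \<inter> path_image g"
    then have "z \<in> p ` {u, w}" using gX e by (auto simp: drawn_def)
    moreover have "z \<in> p ` e" using z d e calculation uw unfolding plane_drawing_def by blast
    moreover have "e \<subseteq> verts G" using G e by (auto simp: simple_graph_def)
    ultimately show "z \<in> p ` (e \<inter> {u, w})"
      using uw inj_on_image_Int[OF inj, of e "{u, w}"] by blast
  qed
  have "plane_drawing (add_edge G u w) p \<gamma>'"
    unfolding plane_drawing_def add_edge_def graph.sel
  proof (intro conjI ballI impI)
    fix e assume e: "e \<in> insert {u, w} (edges G)"
    have de: "arc (\<gamma> e) \<and> {pathstart (\<gamma> e), pathfinish (\<gamma> e)} = p ` e \<and> path_image (\<gamma> e) \<inter> p ` verts G \<subseteq> p ` e"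
      if "e \<in> edges G"
      using d that unfolding plane_drawing_def by simp
    show "arc (\<gamma>' e)" using e de g(1) old new by auto
    show "{pathstart (\<gamma>' e), pathfinish (\<gamma>' e)} = p ` e"
    proof (cases "e = {u, w}")
      case True then show ?thesis using g new by auto
    next
      case False then show ?thesis using e de old by simp
    qed
    show "path_image (\<gamma>' e) \<inter> p ` verts G \<subseteq> p ` e"
    proof (cases "e = {u, w}")
      case True then show ?thesis using gX new by (auto simp: drawn_def)
    next
      case False then show ?thesis using e de old by simp
    qed
    fix e' assume e': "e' \<in> insert {u, w} (edges G)" and "e \<noteq> e'"
    show "path_image (\<gamma>' e) \<inter> path_image (\<gamma>' e') \<subseteq> p ` (e \<inter> e')"
    proof (cases "e = {u, w} \<or> e' = {u, w}")
      case True
      then show ?thesis using cross[of e] cross[of e'] e e' \<open>e \<noteq> e'\<close> old new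
        by (auto simp: Int_commute)
    next
      case False then show ?thesis using e e' \<open>e \<noteq> e'\<close> old d by (auto simp: plane_drawing_def)
    qed
  qed (rule inj)
  then show ?thesis by (auto simp: planar_def)
qed

text \<open>Remove a vertex with at most one neighbour in \<open>S\<close>. This takes away an
  isolated point, or an arc that meets the remaining drawing in at most one point. Neither separates
  the plane alone, and Janiszewski's theorem combines it with the rest.\<close>

lemma connected_complement_drawn_forest:
  assumes G: "simple_graph G" and d: "plane_drawing G p \<gamma>" and S: "S \<subseteq> verts G"
    and forest: "\<And>T. T \<subseteq> S \<Longrightarrow> min_degree_two G T \<Longrightarrow> T = {}"
  shows "connected (- drawn p \<gamma> (induced G S))"
proof -
  note dd = d[unfolded plane_drawing_def]
  have "finite S" using S G finite_subset by (auto simp: simple_graph_def)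
  then show ?thesis using S forest
  proof (induction S rule: finite_psubset_induct)
    case (psubset S)
    show ?case
    proof (cases "S = {}")
      case True
      have "{} \<notin> edges G" using G by (auto simp: simple_graph_def)
      then have "drawn p \<gamma> (induced G S) = {}" using True by (auto simp: drawn_def induced_def)
      then show ?thesis using connected_UNIV by simp
    next
      case False
      then have "\<not> min_degree_two G S" using psubset.prems(2)[of S] by auto
      then obtain v where v: "v \<in> S"
        and no_two: "\<not> (\<exists>a\<in>S. \<exists>b\<in>S. a \<noteq> b \<and> {v, a} \<in> edges G \<and> {v, b} \<in> edges G)"
        unfolding min_degree_two_def by blast
      have one: "a = b" if "a \<in> S" "b \<in> S" "{v, a} \<in> edges G" "{v, b} \<in> edges G" for a b
        using no_two that by blast
      define S' where "S' = S - {v}"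
      let ?D = "drawn p \<gamma> (induced G S')"
      have IH: "connected (- ?D)"
      proof (rule psubset.IH)
        show "S' \<subset> S" using v by (auto simp: S'_def)
        show "S' \<subseteq> verts G" using psubset.prems by (auto simp: S'_def)
        show "T = {}" if "T \<subseteq> S'" "min_degree_two G T" for T
          using psubset.prems(2)[of T] that by (auto simp: S'_def)
      qed
      have D: "?D = p ` S' \<union> (\<Union>e\<in>{e \<in> edges G. e \<subseteq> S'}. path_image (\<gamma> e))"
        by (simp add: drawn_def induced_def)
      have "compact ?D"
        using d finite_edges[OF G] psubset.hyps
        by (intro compact_drawn[OF d]) (auto simp: induced_def S'_def)
      have pv: "p v \<notin> ?D"
      proof
        assume "p v \<in> ?D"
        then consider "p v \<in> p ` S'" | e where "e \<in> edges G" "e \<subseteq> S'" "p v \<in> path_image (\<gamma> e)"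
          unfolding D by blast
        then show False
        proof cases
          case 1
          then show ?thesis using dd v psubset.prems by (auto simp: S'_def dest: inj_onD)
        next
          case 2
          then have "path_image (\<gamma> e) \<inter> p ` verts G \<subseteq> p ` e" using dd by simp
          moreover have "p v \<in> p ` verts G" using v psubset.prems(1) by auto
          ultimately have "p v \<in> p ` e" using 2 by blast
          moreover have "e \<subseteq> verts G" using 2 psubset.prems by (auto simp: S'_def)
          ultimately have "v \<in> e" using dd v psubset.prems by (meson inj_on_image_mem_iff subsetD)
          then show ?thesis using 2 by (auto simp: S'_def)
        qed
      qed
      show ?thesis
      proof (cases "\<exists>a\<in>S. {v, a} \<in> edges G")
        case False
        have "e \<subseteq> S'" if "e \<in> edges G" "e \<subseteq> S" for e
        proof -
          have "v \<notin> e"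
          proof
            assume "v \<in> e"
            then obtain w where "e = {v, w}" using edgeE[OF G \<open>e \<in> edges G\<close>] by blast
            then show False using False that by auto
          qed
          then show ?thesis using that by (auto simp: S'_def)
        qed
        then have "{e \<in> edges G. e \<subseteq> S} = {e \<in> edges G. e \<subseteq> S'}" by (auto simp: S'_def)
        then have "drawn p \<gamma> (induced G S) = {p v} \<union> ?D"
          using v unfolding D by (auto simp: drawn_def induced_def S'_def)
        moreover have "connected (- ({p v} \<union> ?D))"
          using pv IH \<open>compact ?D\<close>
          by (intro Janiszewski_connected connected_punctured_universe)
            (auto simp: compact_imp_closed)
        ultimately show ?thesis by simp
      next
        case True
        then obtain a where a: "a \<in> S" "{v, a} \<in> edges G" by auto
        let ?e = "{v, a}"
        have "v \<noteq> a" using edge_vertices[OF G a(2)] by auto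
        have "e \<subseteq> S' \<or> e = ?e" if "e \<in> edges G" "e \<subseteq> S" for e
        proof (cases "v \<in> e")
          case True
          then obtain w where w: "e = {v, w}" using edgeE[OF G \<open>e \<in> edges G\<close>] by blast
          then show ?thesis using one[of w a] a that by auto
        qed (use that in \<open>auto simp: S'_def\<close>)
        then have eq: "{e \<in> edges G. e \<subseteq> S} = insert ?e {e \<in> edges G. e \<subseteq> S'}"
          using a v by (auto simp: S'_def)
        have arc: "arc (\<gamma> ?e)" "{pathstart (\<gamma> ?e), pathfinish (\<gamma> ?e)} = p ` ?e" using dd a by auto
        then have "p v \<in> path_image (\<gamma> ?e)" "p a \<in> path_image (\<gamma> ?e)"
          using pathstart_in_path_image[of "\<gamma> ?e"] pathfinish_in_path_image[of "\<gamma> ?e"]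
          by (auto simp: doubleton_eq_iff)
        then have "drawn p \<gamma> (induced G S) = path_image (\<gamma> ?e) \<union> ?D"
          using v a unfolding D by (auto simp: drawn_def induced_def S'_def eq)
        moreover have "connected (- (path_image (\<gamma> ?e) \<union> ?D))"
        proof (rule Janiszewski_connected)
          have "path_image (\<gamma> ?e) \<inter> ?D \<subseteq> p ` ?e"
          proof
            fix z assume z: "z \<in> path_image (\<gamma> ?e) \<inter> ?D"
            then consider "z \<in> p ` S'"
              | e where "e \<in> edges G" "e \<subseteq> S'" "z \<in> path_image (\<gamma> e)"
              unfolding D by blast
            then show "z \<in> p ` ?e"
            proof cases
              case 1
              then have "z \<in> p ` verts G" using psubset.prems(1) by (auto simp: S'_def)
              moreover have "path_image (\<gamma> ?e) \<inter> p ` verts G \<subseteq> p ` ?e"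
                by (rule plane_drawing_vertex_on_edge[OF d a(2)])
              ultimately show ?thesis using z by blast
            next
              case 2
              then have "e \<noteq> ?e" by (auto simp: S'_def)
              then have "path_image (\<gamma> e) \<inter> path_image (\<gamma> ?e) \<subseteq> p ` (e \<inter> ?e)"
                using 2(1) dd a(2) by simp
              then have "z \<in> p ` (e \<inter> ?e)" using 2 z by blast
              then show ?thesis by blast
            qed
          qed
          then have "path_image (\<gamma> ?e) \<inter> ?D \<subseteq> {p a}" using pv by auto
          then show "connected (path_image (\<gamma> ?e) \<inter> ?D)"
            by (metis connected_empty connected_sing subset_singletonD)
        qed (use arc IH \<open>compact ?D\<close> in \<open>auto simp: compact_imp_closed compact_arc_image intro!: connected_arc_complement\<close>)
        ultimately show ?thesis by simp
      qed
    qed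
  qed
qed

text \<open>Deleting \<open>e\<close> but keeping all vertices leaves a compact set that the arc of
  \<open>e\<close> meets only at its ends, so contact of the face with an inner point of the arc
  spreads to all of it.\<close>

lemma face_closure_contains_end:
  assumes G: "simple_graph G" and d: "plane_drawing G p \<gamma>"
    and F: "F \<in> components (- drawn p \<gamma> G)"
    and e: "e \<in> edges G" "v \<in> e" and z: "z \<in> path_image (\<gamma> e)" "z \<notin> p ` verts G" "z \<in> closure F"
  shows "p v \<in> closure F"
proof -
  note dd = d[unfolded plane_drawing_def]
  let ?H = "Graph (verts G) (edges G - {e})"
  have K: "compact (drawn p \<gamma> ?H)"
    using G by (intro compact_drawn[OF d]) (auto simp: finite_edges simple_graph_def)
  have eq: "drawn p \<gamma> G = drawn p \<gamma> ?H \<union> path_image (\<gamma> e)" using e by (auto simp: drawn_def)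
  have arc: "arc (\<gamma> e)" and ends: "{pathstart (\<gamma> e), pathfinish (\<gamma> e)} = p ` e" using dd e by auto
  have meet: "path_image (\<gamma> e) \<inter> drawn p \<gamma> ?H \<subseteq> {pathstart (\<gamma> e), pathfinish (\<gamma> e)}"
  proof
    fix y assume y: "y \<in> path_image (\<gamma> e) \<inter> drawn p \<gamma> ?H"
    then consider "y \<in> p ` verts G" | e' where "e' \<in> edges G" "e' \<noteq> e" "y \<in> path_image (\<gamma> e')"
      by (auto simp: drawn_def)
    then have "y \<in> p ` e" by cases (use y dd e in blast)+
    then show "y \<in> {pathstart (\<gamma> e), pathfinish (\<gamma> e)}" using ends by simp
  qed
  obtain t where t: "0 \<le> t" "t \<le> 1" "z = \<gamma> e t" using z by (auto simp: path_image_def)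
  have "e \<subseteq> verts G" using G e by (auto simp: simple_graph_def)
  then have "z \<notin> {pathstart (\<gamma> e), pathfinish (\<gamma> e)}" using z ends by auto
  then have "0 < t" "t < 1" using t by (auto simp: pathstart_def pathfinish_def less_le)
  then have "path_image (\<gamma> e) \<subseteq> closure F"
    using arc_subset_closure_face[OF K arc meet F[unfolded eq]] t z by auto
  moreover have "p v \<in> path_image (\<gamma> e)"
    using imageI[OF e(2), of p] pathstart_in_path_image[of "\<gamma> e"] pathfinish_in_path_image[of "\<gamma> e"]
    unfolding ends[symmetric] by auto
  ultimately show ?thesis by blast
qed

text \<open>The witness is found on a path that avoids the drawing of the separator: the piece between
  its last visit to the part of \<open>A\<close> and the next visit to the part of \<open>B\<close> lies in a single face.\<close>

lemma common_face_across_separator: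
  assumes G: "simple_graph G" and d: "plane_drawing G p \<gamma>"
    and V: "verts G = A \<union> S \<union> B" and disj: "A \<inter> S = {}" "B \<inter> S = {}" "A \<inter> B = {}"
    and sep: "\<And>e. e \<in> edges G \<Longrightarrow> e \<inter> A = {} \<or> e \<inter> B = {}"
    and ne: "A \<noteq> {}" "B \<noteq> {}"
    and conn: "connected (- drawn p \<gamma> (induced G S))"
  obtains F a b where "F \<in> components (- drawn p \<gamma> G)" "a \<in> A" "b \<in> B"
    "p a \<in> closure F" "p b \<in> closure F"
proof -
  note dd = d[unfolded plane_drawing_def]
  have inj: "inj_on p (verts G)" using dd by blast
  have fin: "finite (verts G)" "finite (edges G)" using G finite_edges by (auto simp: simple_graph_def)
  have eV: "e \<subseteq> verts G" if "e \<in> edges G" for e using that G by (auto simp: simple_graph_def)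
  have vert_edge: "v \<in> e" if "p v \<in> path_image (\<gamma> e)" "v \<in> verts G" "e \<in> edges G" for v e
  proof -
    have "p v \<in> p ` e" using dd that by blast
    then show ?thesis using inj that eV by (meson inj_on_image_mem_iff)
  qed
  define XS where "XS = drawn p \<gamma> (induced G S)"
  \<comment> \<open>Edges between \<open>C\<close> and \<open>S\<close> are included. Thus
    \<open>XS\<close>, \<open>Y A\<close> and \<open>Y B\<close> cover the drawing.\<close>
  define Y where "Y C = drawn p \<gamma> (Graph C {e \<in> edges G. e \<inter> C \<noteq> {}})" for C
  have XS: "XS = p ` S \<union> (\<Union>e\<in>{e \<in> edges G. e \<subseteq> S}. path_image (\<gamma> e))"
    by (simp add: XS_def drawn_def induced_def)
  have Y: "Y C = p ` C \<union> (\<Union>e\<in>{e \<in> edges G. e \<inter> C \<noteq> {}}. path_image (\<gamma> e))" for C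
    by (simp add: Y_def drawn_def)
  have closedXS: "closed XS" unfolding XS_def
    using fin V by (intro compact_imp_closed compact_drawn[OF d]) (auto simp: induced_def)
  have closedY: "closed (Y C)" if "C \<subseteq> verts G" for C unfolding Y_def
    using fin V that finite_subset by (intro compact_imp_closed compact_drawn[OF d]) auto
  have X: "drawn p \<gamma> G = XS \<union> Y A \<union> Y B"
  proof
    have "e \<subseteq> S \<or> e \<inter> A \<noteq> {} \<or> e \<inter> B \<noteq> {}" if "e \<in> edges G" for e using eV[OF that] V by blast
    then have "path_image (\<gamma> e) \<subseteq> XS \<union> Y A \<union> Y B" if "e \<in> edges G" for e
      using that unfolding XS Y by fast
    moreover have "p ` verts G \<subseteq> XS \<union> Y A \<union> Y B" unfolding XS Y V by auto
    ultimately show "drawn p \<gamma> G \<subseteq> XS \<union> Y A \<union> Y B" unfolding drawn_def by (simp add: UN_least)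
    have "XS \<subseteq> drawn p \<gamma> G" unfolding drawn_def XS V by auto
    moreover have "Y C \<subseteq> drawn p \<gamma> G" if "C \<subseteq> verts G" for C
      using that unfolding drawn_def Y by auto
    ultimately show "XS \<union> Y A \<union> Y B \<subseteq> drawn p \<gamma> G" using V by auto
  qed
  \<comment> \<open>An edge at \<open>A\<close> and an edge at \<open>B\<close> are different edges,
    so they meet only in common ends, and by \<open>sep\<close> those lie in
    \<open>S\<close>.\<close>
  have AB: "z \<in> XS" if z: "z \<in> Y A" "z \<in> Y B" for z
  proof -
    have no: False if "v \<in> C" "p v \<in> Y C'" "C = A \<and> C' = B \<or> C = B \<and> C' = A" for v C C'
    proof -
      have vV: "v \<in> verts G" "C' \<subseteq> verts G" using that V by auto
      from that(2) consider "p v \<in> p ` C'" | e where "e \<in> edges G" "e \<inter> C' \<noteq> {}" "p v \<in> path_image (\<gamma> e)"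
        unfolding Y by blast
      then show False
      proof cases
        case 1
        then have "v \<in> C'" using inj vV by (meson inj_on_image_mem_iff)
        then show False using that disj by auto
      next
        case 2
        then have "v \<in> e" using vert_edge vV by blast
        then show False using sep[OF 2(1)] 2 that by blast
      qed
    qed
    have "z \<notin> p ` A" "z \<notin> p ` B" using no[of _ A B] no[of _ B A] z by blast+
    then obtain e e' where e: "e \<in> edges G" "e \<inter> A \<noteq> {}" "z \<in> path_image (\<gamma> e)"
      "e' \<in> edges G" "e' \<inter> B \<noteq> {}" "z \<in> path_image (\<gamma> e')" using z unfolding Y by blast
    then have "e \<noteq> e'" using sep by blast
    then have "z \<in> p ` (e \<inter> e')" using e dd by blast
    moreover have "e \<inter> e' \<subseteq> S" using sep e eV[of e] V by blast
    ultimately show ?thesis unfolding XS by blast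
  qed
  have notXS: "p v \<notin> XS" if "v \<in> verts G" "v \<notin> S" for v
  proof
    assume "p v \<in> XS"
    then consider "p v \<in> p ` S" | e where "e \<in> edges G" "e \<subseteq> S" "p v \<in> path_image (\<gamma> e)"
      unfolding XS by blast
    then show False
    proof cases
      case 1 then show ?thesis using inj that V by (metis inj_on_image_mem_iff sup.cobounded2 sup_assoc sup_commute)
    next
      case 2 then show ?thesis using vert_edge that by blast
    qed
  qed
  obtain a0 b0 where ab0: "a0 \<in> A" "b0 \<in> B" using ne by blast
  have "path_connected (- XS)"
    using conn closedXS by (simp add: XS_def[symmetric] connected_open_path_connected open_Compl)
  moreover have "p a0 \<in> - XS" "p b0 \<in> - XS" using notXS ab0 V disj by auto
  ultimately obtain c where c: "path c" "path_image c \<subseteq> - XS" "pathstart c = p a0" "pathfinish c = p b0"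
    unfolding path_connected_def by blast
  have contc: "continuous_on {0..1} c" using c by (simp add: path_def)
  have c_notXS: "c t \<notin> XS" if "t \<in> {0..1}" for t using c(2) that unfolding path_image_def by blast
  have c_disj: "c t \<notin> Y A \<inter> Y B" if "t \<in> {0..1}" for t using AB c_notXS that by blast
  have AB_verts: "A \<subseteq> verts G" "B \<subseteq> verts G" using V by auto
  have "c 0 \<in> Y A" "c 1 \<in> Y B" using c ab0 by (auto simp: Y pathstart_def pathfinish_def)
  then obtain s t where st: "0 \<le> s" "s < t" "t \<le> 1" "c s \<in> Y A" "c t \<in> Y B"
    "\<And>r. s < r \<Longrightarrow> r \<le> 1 \<Longrightarrow> c r \<notin> Y A" "\<And>r. s \<le> r \<Longrightarrow> r < t \<Longrightarrow> c r \<notin> Y B"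
    using last_exit_first_entry[OF contc closedY[OF AB_verts(1)] closedY[OF AB_verts(2)] _ _ c_disj]
    by blast
  define R where "R = c ` {s<..<t}"
  have "connected R" unfolding R_def
    by (intro connected_continuous_image continuous_on_subset[OF contc]) (use st in auto)
  moreover have "R \<subseteq> - drawn p \<gamma> G"
  proof -
    have "c r \<notin> XS \<union> Y A \<union> Y B" if "s < r" "r < t" for r
      using st(6)[of r] st(7)[of r] c_notXS[of r] that st(1,3) by auto
    then show ?thesis unfolding R_def X by auto
  qed
  moreover have "R \<noteq> {}" using st by (auto simp: R_def)
  ultimately obtain F where F: "F \<in> components (- drawn p \<gamma> G)" "R \<subseteq> F"
    by (metis exists_component_superset subset_empty)
  have "c ` closure {s<..<t} \<subseteq> closure R"
    by (rule image_closure_subset)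
      (use st in \<open>auto simp: R_def closure_subset[THEN subsetD] intro!: continuous_on_subset[OF contc]\<close>)
  then have cl: "c s \<in> closure F" "c t \<in> closure F"
    using st(2) closure_mono[OF F(2)] by (auto simp: image_subset_iff)
  \<comment> \<open>The point \<open>z\<close> lies on an edge with an end in \<open>C\<close>. If
    it is a vertex outside \<open>C\<close>, it is not in \<open>S\<close> because \<open>z\<close>
    avoids \<open>XS\<close>, and not in \<open>C'\<close> by \<open>sep\<close>; so otherwise it is
    an inner point of the edge.\<close>
  have reach: "\<exists>a\<in>C. p a \<in> closure F"
    if z: "z \<in> Y C" "z \<notin> XS" "z \<in> closure F" and C: "C = A \<and> C' = B \<or> C = B \<and> C' = A" for z C C'
  proof (cases "z \<in> p ` C")
    case True then show ?thesis using z by auto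
  next
    case False
    then obtain e v where e: "e \<in> edges G" "v \<in> e" "v \<in> C" "z \<in> path_image (\<gamma> e)"
      using z unfolding Y by blast
    have "z \<notin> p ` verts G"
    proof
      assume "z \<in> p ` verts G"
      then obtain w where w: "w \<in> verts G" "z = p w" by auto
      then have "w \<in> e" using vert_edge e by blast
      moreover have "w \<in> C'" using w False z V C unfolding XS by auto
      ultimately show False using sep[OF e(1)] e C by blast
    qed
    then show ?thesis using face_closure_contains_end[OF G d F(1) e(1,2,4)] z e by blast
  qed
  obtain a where "a \<in> A" "p a \<in> closure F"
    using reach[of "c s" A B] st cl c_notXS[of s] by auto
  moreover obtain b where "b \<in> B" "p b \<in> closure F"
    using reach[of "c t" B A] st cl c_notXS[of t] by auto
  ultimately show ?thesis using that F by blast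
qed

lemma CAN_separator_contains_cycle:
  assumes G: "simple_graph G" and can: "CAN G"
    and V: "verts G = A \<union> S \<union> B" and disj: "A \<inter> S = {}" "B \<inter> S = {}" "A \<inter> B = {}"
    and sep: "\<And>e. e \<in> edges G \<Longrightarrow> e \<inter> A = {} \<or> e \<inter> B = {}"
    and ne: "A \<noteq> {}" "B \<noteq> {}"
  shows "\<exists>T\<subseteq>S. T \<noteq> {} \<and> min_degree_two G T"
proof (rule ccontr)
  assume "\<not> ?thesis"
  then have forest: "T = {}" if "T \<subseteq> S" "min_degree_two G T" for T
    using that by blast
  obtain p \<gamma> where rad: "radial_drawing G p \<gamma>"
    using planar_imp_radial_drawing[OF G] can by (auto simp: CAN_def)
  then have d: "plane_drawing G p \<gamma>" by (simp add: radial_drawing_def)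
  have conn: "connected (- drawn p \<gamma> (induced G S))"
    using connected_complement_drawn_forest[OF G d _ forest] V by auto
  obtain F a b where F: "F \<in> components (- drawn p \<gamma> G)" "a \<in> A" "b \<in> B"
    "p a \<in> closure F" "p b \<in> closure F"
    by (rule common_face_across_separator[OF G d V disj sep ne conn])
  have ab: "a \<in> verts G" "b \<in> verts G" "a \<noteq> b" using F V disj by auto
  have "{a, b} \<notin> edges G" using sep[of "{a, b}"] F by auto
  moreover from this have "planar (add_edge G a b)"
    using planar_add_edge_in_face[OF G rad ab _ F(1,4,5)] by blast
  ultimately show False using can ab by (auto simp: CAN_def)
qed

subsection \<open>Nonplanarity of the complete graph on five vertices\<close>

text \<open>A drawing fixes only the unordered pair of ends of an edge, whereas joining three edges
  into a closed curve needs directions.\<close>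

lemma arc_orient:
  assumes "arc g" "{pathstart g, pathfinish g} = {P, Q}"
  obtains h where "arc h" "pathstart h = P" "pathfinish h = Q" "path_image h = path_image g"
proof (cases "pathstart g = P \<and> pathfinish g = Q")
  case True then show ?thesis using that assms by blast
next
  case False
  then have "pathstart g = Q" "pathfinish g = P" using assms(2) by (auto simp: doubleton_eq_iff)
  then show ?thesis using that[of "reversepath g"] assms(1) by (simp add: arc_reversepath)
qed

text \<open>What remains is the continuous image of a half-open interval. It is applied to edges
  that touch a triangle only at the removed end.\<close>

lemma connected_arc_minus_end:
  fixes g :: "real \<Rightarrow> 'a::real_normed_vector"
  assumes "arc g" "P = pathstart g \<or> P = pathfinish g"
  shows "connected (path_image g - {P})"
proof -
  have *: "connected (path_image h - {pathstart h})" if "arc h" for h :: "real \<Rightarrow> 'a"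
  proof -
    have cont: "continuous_on {0..1} h" and inj: "inj_on h {0..1}"
      using that by (auto simp: arc_def path_def)
    have "path_image h - {pathstart h} = h ` ({0..1} - {0})"
      using inj_on_image_set_diff[OF inj, of "{0..1}" "{0}"] by (auto simp: path_image_def pathstart_def)
    also have "{0..1} - {0} = {0<..(1::real)}" by auto
    finally show ?thesis
      using connected_continuous_image[OF continuous_on_subset[OF cont, of "{0<..1}"]]
      by (simp add: subset_iff)
  qed
  show ?thesis
    using *[OF assms(1)] *[OF arc_reversepath[OF assms(1)]] assms(2) by auto
qed

text \<open>By the Jordan curve theorem the inside and the outside both have the whole curve as
  frontier. Choosing \<open>D\<close> according to \<open>z\<close> spares the later argument a
  distinction between them.\<close>

lemma triangle_other_side:
  fixes g\<^sub>1 g\<^sub>2 g\<^sub>3 :: "real \<Rightarrow> complex"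
  assumes arcs: "arc g\<^sub>1" "arc g\<^sub>2" "arc g\<^sub>3"
    and ends: "{pathstart g\<^sub>1, pathfinish g\<^sub>1} = {P, Q}" "{pathstart g\<^sub>2, pathfinish g\<^sub>2} = {Q, R}"
      "{pathstart g\<^sub>3, pathfinish g\<^sub>3} = {R, P}"
    and meet: "path_image g\<^sub>1 \<inter> path_image g\<^sub>2 \<subseteq> {Q}" "path_image g\<^sub>2 \<inter> path_image g\<^sub>3 \<subseteq> {R}"
      "path_image g\<^sub>1 \<inter> path_image g\<^sub>3 \<subseteq> {P}"
    and T: "T = path_image g\<^sub>1 \<union> path_image g\<^sub>2 \<union> path_image g\<^sub>3" and z: "z \<notin> T"
  obtains D where "connected D" "D \<noteq> {}" "D \<inter> T = {}" "z \<notin> D" "frontier D = T"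
proof -
  obtain h1 where h1: "arc h1" "pathstart h1 = P" "pathfinish h1 = Q" "path_image h1 = path_image g\<^sub>1"
    by (rule arc_orient[OF arcs(1) ends(1)])
  obtain h2 where h2: "arc h2" "pathstart h2 = Q" "pathfinish h2 = R" "path_image h2 = path_image g\<^sub>2"
    by (rule arc_orient[OF arcs(2) ends(2)])
  obtain h3 where h3: "arc h3" "pathstart h3 = R" "pathfinish h3 = P" "path_image h3 = path_image g\<^sub>3"
    by (rule arc_orient[OF arcs(3) ends(3)])
  let ?c = "(h1 +++ h2) +++ h3"
  have "arc (h1 +++ h2)" using h1 h2 meet by (intro arc_join) auto
  moreover have im: "path_image (h1 +++ h2) = path_image g\<^sub>1 \<union> path_image g\<^sub>2"
    using h1 h2 by (simp add: path_image_join)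
  ultimately have "simple_path ?c" using h1 h2 h3 meet by (intro simple_path_join_loop) auto
  moreover have loop: "pathfinish ?c = pathstart ?c" using h1 h2 h3 by simp
  moreover have "path_image ?c = T" using h1 h2 h3 im T by (subst path_image_join) auto
  ultimately have J: "inside T \<noteq> {}" "outside T \<noteq> {}" "connected (inside T)" "connected (outside T)"
    "inside T \<inter> outside T = {}" "frontier (inside T) = T" "frontier (outside T) = T"
    using Jordan_inside_outside[of ?c] by auto
  show ?thesis
  proof (cases "z \<in> inside T")
    case True
    then show ?thesis using that[of "outside T"] J outside_no_overlap[of T] by blast
  next
    case False
    then show ?thesis using that[of "inside T"] J inside_no_overlap[of T] by blast
  qed
qed

text \<open>Let \<open>a, b, c, x\<close> span a \<open>K\<^sub>4\<close> and let \<open>D\<close> be the side of the triangle \<open>abc\<close> away from the fifth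
  vertex \<open>y\<close>. None of the triangles through \<open>x\<close> separates \<open>y\<close> from \<open>D\<close>: an edge at \<open>y\<close> leads to the
  vertex opposite to it, which lies on the boundary of \<open>D\<close>. By Janiszewski's theorem neither does
  their union, although it contains the triangle \<open>abc\<close>.\<close>

lemma no_plane_drawing_K5:
  assumes d: "plane_drawing G p \<gamma>" and W: "W \<subseteq> verts G" "card W = 5"
    and clique: "\<And>u v. u \<in> W \<Longrightarrow> v \<in> W \<Longrightarrow> u \<noteq> v \<Longrightarrow> {u, v} \<in> edges G"
  shows False
proof -
  obtain a b c x y where W5: "W = {a, b, c, x, y}" "distinct [a, b, c, x, y]"
  proof -
    have "finite W" using W by (intro card_ge_0_finite) auto
    then obtain xs where xs: "distinct xs" "set xs = W" using finite_distinct_list by blast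
    then have "length xs = 5" using W distinct_card by fastforce
    then obtain a b c x y where "xs = [a, b, c, x, y]"
      by (auto simp: length_Suc_conv numeral_eq_Suc)
    then show ?thesis using xs that by auto
  qed
  define A where "A u v = path_image (\<gamma> {u, v})" for u v
  have A_sym: "A u v = A v u" for u v by (simp add: A_def insert_commute)
  have edge: "arc (\<gamma> {u, v}) \<and> {pathstart (\<gamma> {u, v}), pathfinish (\<gamma> {u, v})} = {p u, p v}"
    if "u \<in> W" "v \<in> W" "u \<noteq> v" for u v
    using d clique[OF that] unfolding plane_drawing_def by simp
  have ends: "p u \<in> A u v" if "u \<in> W" "v \<in> W" "u \<noteq> v" for u v
    using edge[OF that] pathstart_in_path_image[of "\<gamma> {u, v}"] pathfinish_in_path_image[of "\<gamma> {u, v}"]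
    unfolding A_def by (auto simp: doubleton_eq_iff)
  have ends': "p v \<in> A u v" if "u \<in> W" "v \<in> W" "u \<noteq> v" for u v
    using ends[of v u] that A_sym by auto
  have meet: "A u v \<inter> A u' v' \<subseteq> p ` ({u, v} \<inter> {u', v'})"
    if "u \<in> W" "v \<in> W" "u \<noteq> v" "u' \<in> W" "v' \<in> W" "u' \<noteq> v'" "{u, v} \<noteq> {u', v'}" for u v u' v'
    using d clique[of u v] clique[of u' v'] that unfolding plane_drawing_def A_def by simp
  have meet1: "A u v \<inter> A u w \<subseteq> {p u}" if "u \<in> W" "v \<in> W" "w \<in> W" "u \<noteq> v" "u \<noteq> w" "v \<noteq> w" for u v w
    using meet[of u v u w] that by (auto simp: doubleton_eq_iff)
  have meet0: "A u v \<inter> A w z = {}"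
    if "u \<in> W" "v \<in> W" "w \<in> W" "z \<in> W" "distinct [u, v, w, z]" for u v w z
    using meet[of u v w z] that by (auto simp: doubleton_eq_iff)
  have comp: "compact (A u v)" "connected (A u v)" if "u \<in> W" "v \<in> W" "u \<noteq> v" for u v
    using edge[OF that] unfolding A_def by (auto intro: compact_arc_image connected_arc_image)
  have away: "p w \<notin> A u v" if "u \<in> W" "v \<in> W" "w \<in> W" "distinct [u, v, w]" for u v w
  proof -
    have "path_image (\<gamma> {u, v}) \<inter> p ` verts G \<subseteq> p ` {u, v}"
      by (rule plane_drawing_vertex_on_edge[OF d clique]) (use that in auto)
    moreover have "inj_on p W"
      using d unfolding plane_drawing_def by (elim conjE) (rule inj_on_subset[OF _ W(1)])
    then have "p w \<notin> p ` {u, v}" using that by (auto dest: inj_onD)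
    ultimately show ?thesis using that W unfolding A_def by blast
  qed
  have WW: "a \<in> W" "b \<in> W" "c \<in> W" "x \<in> W" "y \<in> W" using W5 by auto
  note ne = W5(2)[simplified]
  have abc: "a \<noteq> b" "b \<noteq> c" "c \<noteq> a" using ne by auto
  define T where "T = A a b \<union> A b c \<union> A c a"
  have yT: "p y \<notin> T" using away WW ne unfolding T_def by auto
  have m: "path_image (\<gamma> {a, b}) \<inter> path_image (\<gamma> {b, c}) \<subseteq> {p b}"
    "path_image (\<gamma> {b, c}) \<inter> path_image (\<gamma> {c, a}) \<subseteq> {p c}"
    "path_image (\<gamma> {a, b}) \<inter> path_image (\<gamma> {c, a}) \<subseteq> {p a}"
    using meet1[of b a c] meet1[of c b a] meet1[of a b c] A_sym[of a b] A_sym[of b c] A_sym[of a c] WW abc abc[symmetric]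
    unfolding A_def by simp_all
  have e: "arc (\<gamma> {a, b})" "arc (\<gamma> {b, c})" "arc (\<gamma> {c, a})"
    "{pathstart (\<gamma> {a, b}), pathfinish (\<gamma> {a, b})} = {p a, p b}"
    "{pathstart (\<gamma> {b, c}), pathfinish (\<gamma> {b, c})} = {p b, p c}"
    "{pathstart (\<gamma> {c, a}), pathfinish (\<gamma> {c, a})} = {p c, p a}"
    using edge[OF WW(1,2) abc(1)] edge[OF WW(2,3) abc(2)] edge[OF WW(3,1) abc(3)] by simp_all
  obtain D where D: "connected D" "D \<noteq> {}" "D \<inter> T = {}" "p y \<notin> D" "frontier D = T"
    by (rule triangle_other_side[OF e m T_def[unfolded A_def] yT])
  have crosses: "C \<inter> T \<noteq> {}" if "connected C" "u \<in> C" "u \<in> D" "w \<in> C" "w \<notin> D" for C u w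
    using connected_Int_frontier[of C D] that D(5) by auto
  have xyT: "A x y \<inter> T = {}" using meet0[of x y] WW ne unfolding T_def by auto
  \<comment> \<open>The edge from \<open>x\<close> to \<open>y\<close> is disjoint from the
    triangle, so \<open>x\<close> is on the same side as \<open>y\<close>.\<close>
  have xD: "p x \<notin> D"
    using crosses[OF comp(2)[of x y], of "p x" "p y"] xyT ends[of x y] ends'[of x y] WW ne D(4) by auto
  \<comment> \<open>Without its foot \<open>p v\<close>, the spoke misses the triangle and starts at
    \<open>x\<close>, outside \<open>D\<close>.\<close>
  have spoke: "A x v \<inter> D = {}" if v: "v = a \<or> v = b \<or> v = c" for v
  proof -
    have vW: "v \<in> W" "v \<noteq> x" using v WW ne by auto
    have T_v: "A x v \<inter> T \<subseteq> {p v}"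
    proof -
      have "A v x \<inter> A u w \<subseteq> {p v}" if "u \<in> {a,b,c}" "w \<in> {a,b,c}" "u \<noteq> w" for u w
        using meet[of v x u w] that v WW ne by (auto simp: doubleton_eq_iff)
      then have "A v x \<inter> A a b \<subseteq> {p v}" "A v x \<inter> A b c \<subseteq> {p v}" "A v x \<inter> A c a \<subseteq> {p v}"
        using ne by auto
      then show ?thesis unfolding T_def A_sym[of x v] by blast
    qed
    have "connected (A x v - {p v})"
      unfolding A_def using edge[of x v] vW WW by (intro connected_arc_minus_end) (auto simp: doubleton_eq_iff)
    moreover have "p x \<in> A x v - {p v}" using ends[of x v] away[of v y x] ends[of v y] vW WW ne v by auto
    ultimately have "(A x v - {p v}) \<inter> D = {}"
      using crosses[of "A x v - {p v}" _ "p x"] T_v xD by blast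
    moreover have "p v \<in> T" unfolding T_def using v ends WW ne by auto
    ultimately show ?thesis using D(3) by blast
  qed
  obtain r where r: "r \<in> D" using D(2) by blast
  \<comment> \<open>The connecting set is the edge from \<open>y\<close> to \<open>v\<close>
    together with \<open>D\<close>; they are attached at \<open>p v\<close>, which lies on the
    frontier of \<open>D\<close>.\<close>
  have unsep: "connected_component (- Q) (p y) r"
    if v: "v = a \<or> v = b \<or> v = c" and Q: "Q \<inter> A y v = {}" "Q \<inter> D = {}" for v Q
  proof -
    have vW: "v \<in> W" "v \<noteq> y" using v WW ne by auto
    have "p v \<in> T" unfolding T_def using v ends WW ne by auto
    then have "p v \<in> closure D" using D(5) unfolding frontier_def by auto
    then have "connected (insert (p v) D)"
      using connected_intermediate_closure[OF D(1)] closure_subset by (metis insert_subset subset_insertI)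
    then have "connected (A y v \<union> insert (p v) D)"
      using comp(2)[of y v] ends'[of y v] vW WW by (intro connected_Un) auto
    moreover have "A y v \<union> insert (p v) D \<subseteq> - Q" using Q ends'[of y v] vW WW by auto
    ultimately show ?thesis
      unfolding connected_component_def using r ends[of y v] vW WW
      by (intro exI[of _ "A y v \<union> insert (p v) D"]) auto
  qed
  have DA: "D \<inter> A a b = {}" "D \<inter> A b c = {}" "D \<inter> A c a = {}" using D(3) unfolding T_def by auto
  \<comment> \<open>Each triangle is named after the vertex of \<open>abc\<close> that it omits. The
    intersections used below are connected: \<open>Ta\<close> and \<open>Tb\<close> share the edge
    \<open>c x\<close>, and their union meets \<open>Tc\<close> in the path from \<open>b\<close>
    through \<open>x\<close> to \<open>a\<close>.\<close>
  define Ta where "Ta = A b c \<union> A c x \<union> A x b"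
  define Tb where "Tb = A c a \<union> A c x \<union> A x a"
  define Tc where "Tc = A a b \<union> A b x \<union> A x a"
  have cpt: "compact Ta" "compact Tb" "compact Tc"
    unfolding Ta_def Tb_def Tc_def using comp WW ne by (auto intro!: compact_Un)
  have sp: "A x a \<inter> D = {}" "A x b \<inter> D = {}" "A x c \<inter> D = {}" using spoke by auto
  have ua: "connected_component (- Ta) (p y) r"
    using meet0[of y a b c] meet0[of y a c x] meet0[of y a x b] WW ne DA sp A_sym[of c x]
    by (intro unsep[of a]) (auto simp: Ta_def)
  have ub: "connected_component (- Tb) (p y) r"
    using meet0[of y b c a] meet0[of y b c x] meet0[of y b x a] WW ne DA sp A_sym[of c x]
    by (intro unsep[of b]) (auto simp: Tb_def)
  have uc: "connected_component (- Tc) (p y) r"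
    using meet0[of y c a b] meet0[of y c b x] meet0[of y c x a] WW ne DA sp A_sym[of b x]
    by (intro unsep[of c]) (auto simp: Tc_def)
  have "Ta \<inter> Tb = A c x"
  proof -
    have "A b c \<inter> A c a \<subseteq> {p c}" "A x b \<inter> A x a \<subseteq> {p x}" "A b c \<inter> A x a = {}" "A x b \<inter> A c a = {}"
      using meet1[of c b a] meet1[of x b a] meet0[of b c x a] meet0[of x b c a] A_sym[of b c] WW ne by auto
    moreover have "p c \<in> A c x" "p x \<in> A c x" using ends[of c x] ends'[of c x] WW ne by auto
    ultimately show ?thesis
      using meet1[of c b x] meet1[of c a x] meet1[of x b c] meet1[of x a c] A_sym[of b c] A_sym[of c x] A_sym[of x b] WW ne
      unfolding Ta_def Tb_def by auto
  qed
  then have uab: "connected_component (- (Ta \<union> Tb)) (p y) r"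
    using comp(2)[of c x] WW ne cpt ua ub by (intro Janiszewski) (auto simp: compact_imp_closed)
  have "(Ta \<union> Tb) \<inter> Tc = A b x \<union> A x a"
  proof -
    have "A b c \<inter> A a b \<subseteq> {p b}" "A c a \<inter> A a b \<subseteq> {p a}" "A c x \<inter> A a b = {}"
      using meet1[of b a c] meet1[of a b c] meet0[of c x a b] A_sym[of a b] A_sym[of a c] WW ne by auto
    moreover have "A x b \<inter> A a b \<subseteq> A b x" "A x a \<inter> A a b \<subseteq> A x a" using A_sym[of x b] by auto
    moreover have "p b \<in> A b x" "p a \<in> A x a" using ends[of b x] ends'[of x a] WW ne by auto
    ultimately show ?thesis using A_sym[of x b] unfolding Ta_def Tb_def Tc_def by blast
  qed
  moreover have "connected (A b x \<union> A x a)"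
    using comp(2)[of b x] comp(2)[of x a] ends[of x a] ends'[of b x] WW ne by (intro connected_Un) auto
  ultimately have "connected_component (- (Ta \<union> Tb \<union> Tc)) (p y) r"
    using cpt uab uc by (intro Janiszewski[of "Ta \<union> Tb"]) (auto simp: compact_imp_closed)
  then obtain C where C: "connected C" "C \<subseteq> - (Ta \<union> Tb \<union> Tc)" "p y \<in> C" "r \<in> C"
    unfolding connected_component_def by auto
  then have "C \<inter> T = {}" unfolding T_def Ta_def Tb_def Tc_def by auto
  then show False using crosses[of C r "p y"] C r D(4) by blast
qed

subsection \<open>Proper minors of \<open>K\<^sub>5 - e\<close>\<close>

lemma edge_endsE:
  assumes "simple_graph G" "e \<in> edges G"
  obtains u v where "e = {u, v}" "u \<noteq> v" "u \<in> verts G" "v \<in> verts G"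
proof -
  have "card e = 2" "e \<subseteq> verts G" using assms by (auto simp: simple_graph_def)
  then show ?thesis using that by (auto simp: card_2_iff)
qed

lemma graph_iso_sym:
  assumes "graph_iso G H"
  shows "graph_iso H G"
proof -
  obtain f where f: "bij_betw f (verts G) (verts H)"
    "\<forall>u\<in>verts G. \<forall>v\<in>verts G. {u, v} \<in> edges G \<longleftrightarrow> {f u, f v} \<in> edges H"
    using assms by (auto simp: graph_iso_def)
  let ?g = "inv_into (verts G) f"
  have g: "bij_betw ?g (verts H) (verts G)" using f(1) by (rule bij_betw_inv_into)
  moreover have "f (?g u) = u" if "u \<in> verts H" for u
    using f(1) that by (rule bij_betw_inv_into_right)
  moreover have "?g u \<in> verts G" if "u \<in> verts H" for u using g that by (rule bij_betw_apply)
  ultimately show ?thesis unfolding graph_iso_def using f(2) by (intro exI[of _ ?g]) auto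
qed

lemma graph_iso_trans:
  assumes "graph_iso G H" "graph_iso H K"
  shows "graph_iso G K"
proof -
  obtain f where f: "bij_betw f (verts G) (verts H)"
    "\<forall>u\<in>verts G. \<forall>v\<in>verts G. {u, v} \<in> edges G \<longleftrightarrow> {f u, f v} \<in> edges H"
    using assms(1) by (auto simp: graph_iso_def)
  obtain g where g: "bij_betw g (verts H) (verts K)"
    "\<forall>u\<in>verts H. \<forall>v\<in>verts H. {u, v} \<in> edges H \<longleftrightarrow> {g u, g v} \<in> edges K"
    using assms(2) by (auto simp: graph_iso_def)
  have "bij_betw (g \<circ> f) (verts G) (verts K)" using f(1) g(1) by (rule bij_betw_trans)
  then show ?thesis unfolding graph_iso_def
    using f g bij_betw_apply[OF f(1)] by (intro exI[of _ "g \<circ> f"]) auto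
qed

text \<open>The drawing is pulled back along \<open>f\<close>; injectivity keeps different edges
  different and preserves their common ends. This covers isomorphic copies and subgraphs at
  once.\<close>

lemma planar_inj_hom:
  assumes H: "simple_graph H" and f: "inj_on f (verts H)" "f ` verts H \<subseteq> verts G"
    and edges: "\<And>e. e \<in> edges H \<Longrightarrow> f ` e \<in> edges G" and "planar G"
  shows "planar H"
proof -
  obtain p \<gamma> where d: "plane_drawing G p \<gamma>" using \<open>planar G\<close> by (auto simp: planar_def)
  have eH: "e \<subseteq> verts H" if "e \<in> edges H" for e using H that by (auto simp: simple_graph_def)
  have "plane_drawing H (p \<circ> f) (\<lambda>e. \<gamma> (f ` e))"
    unfolding plane_drawing_def
  proof (intro conjI ballI impI)
    show "inj_on (p \<circ> f) (verts H)"
      using d f by (intro comp_inj_on) (auto simp: plane_drawing_def intro: inj_on_subset)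
    fix e assume e: "e \<in> edges H"
    show "arc (\<gamma> (f ` e))" "{pathstart (\<gamma> (f ` e)), pathfinish (\<gamma> (f ` e))} = (p \<circ> f) ` e"
      using d edges[OF e] by (simp_all add: plane_drawing_def image_comp)
    show "path_image (\<gamma> (f ` e)) \<inter> (p \<circ> f) ` verts H \<subseteq> (p \<circ> f) ` e"
      using plane_drawing_vertex_on_edge[OF d edges[OF e]] f(2)
      unfolding image_comp[symmetric] by blast
    fix e' assume e': "e' \<in> edges H" "e \<noteq> e'"
    then have "f ` e \<noteq> f ` e'" using inj_on_image_eq_iff[OF f(1) eH[OF e] eH[OF e'(1)]] by simp
    then have "path_image (\<gamma> (f ` e)) \<inter> path_image (\<gamma> (f ` e')) \<subseteq> p ` (f ` e \<inter> f ` e')"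
      using d edges[OF e] edges[OF e'(1)] unfolding plane_drawing_def by simp
    also have "f ` e \<inter> f ` e' = f ` (e \<inter> e')"
      using inj_on_image_Int[OF f(1) eH[OF e] eH[OF e'(1)]] by simp
    finally show "path_image (\<gamma> (f ` e)) \<inter> path_image (\<gamma> (f ` e')) \<subseteq> (p \<circ> f) ` (e \<inter> e')"
      by (simp add: image_comp)
  qed
  then show ?thesis by (auto simp: planar_def)
qed

lemma verts_K5_minus_edge: "verts K5_minus_edge = {..<5}"
  by (simp add: K5_minus_edge_def)

lemma edge_K5_minus_edge:
  "{u, v} \<in> edges K5_minus_edge \<longleftrightarrow> u < 5 \<and> v < 5 \<and> u \<noteq> v \<and> {u, v} \<noteq> {0, 1}"
  by (auto simp: K5_minus_edge_def doubleton_eq_iff)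

lemma edges_K5_minus_edge:
  "edges K5_minus_edge = {{0,2},{0,3},{0,4},{1,2},{1,3},{1,4},{2,3},{2,4},{3,4}}" (is "_ = ?E")
proof
  show "edges K5_minus_edge \<subseteq> ?E"
  proof
    fix e assume "e \<in> edges K5_minus_edge"
    then have "e \<in> {{u, v} |u v. u < 5 \<and> v < 5 \<and> u \<noteq> v}" and ne: "e \<noteq> {0, 1}"
      unfolding K5_minus_edge_def graph.sel by (elim DiffE; simp)+
    then obtain u v :: nat where e: "e = {u, v}" "u < 5" "v < 5" "u \<noteq> v" by auto
    then have "u \<in> {0,1,2,3,4}" "v \<in> {0,1,2,3,4}" by auto
    then show "e \<in> ?E" using e(4) ne unfolding e(1) by (elim insertE emptyE) (simp_all add: insert_commute)
  qed
  show "?E \<subseteq> edges K5_minus_edge" by (auto simp: edge_K5_minus_edge doubleton_eq_iff)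
qed

lemma simple_K5_minus_edge: "simple_graph K5_minus_edge"
  unfolding simple_graph_def edges_K5_minus_edge verts_K5_minus_edge by auto

text \<open>A straight-line drawing: the vertices 0, 4, 1 lie on the imaginary axis at heights 1, 2, 3,
  and each of them is joined to 2 at \<open>-1\<close> and to 3 at \<open>1\<close>.\<close>

lemma planar_K5_minus_edge: "planar K5_minus_edge"
proof -
  define p where "p = (\<lambda>n::nat. if n = 0 then Complex 0 1 else if n = 1 then Complex 0 3
    else if n = 2 then Complex (-1) 0 else if n = 3 then Complex 1 0 else Complex 0 2)"
  define \<gamma> where "\<gamma> e = linepath (p (Min e)) (p (Max e))" for e
  have p: "p 0 = Complex 0 1" "p 1 = Complex 0 3" "p 2 = Complex (-1) 0" "p 3 = Complex 1 0" "p 4 = Complex 0 2"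
    by (simp_all add: p_def)
  have left: "Im z = h * (1 + Re z) \<and> -1 \<le> Re z \<and> Re z \<le> 0"
    if z: "z \<in> closed_segment (Complex 0 h) (Complex (-1) 0)" for z h
  proof -
    obtain t where "0 \<le> t" "t \<le> 1" "z = (1 - t) *\<^sub>R Complex 0 h + t *\<^sub>R Complex (-1) 0"
      using z by (auto simp: in_segment)
    then have "Re z = - t" "Im z = (1 - t) * h" "0 \<le> t" "t \<le> 1" by simp_all
    then show ?thesis by (simp add: algebra_simps)
  qed
  have right: "Im z = h * (1 - Re z) \<and> 0 \<le> Re z \<and> Re z \<le> 1"
    if z: "z \<in> closed_segment (Complex 0 h) (Complex 1 0)" for z h
  proof -
    obtain t where "0 \<le> t" "t \<le> 1" "z = (1 - t) *\<^sub>R Complex 0 h + t *\<^sub>R Complex 1 0"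
      using z by (auto simp: in_segment)
    then have "Re z = t" "Im z = (1 - t) * h" "0 \<le> t" "t \<le> 1" by simp_all
    then show ?thesis by (simp add: algebra_simps)
  qed
  have axis: "Re z = 0 \<and> h \<le> Im z \<and> Im z \<le> k"
    if z: "z \<in> closed_segment (Complex 0 h) (Complex 0 k)" "h \<le> k" for z h k
  proof -
    obtain t where t: "0 \<le> t" "t \<le> 1" "z = (1 - t) *\<^sub>R Complex 0 h + t *\<^sub>R Complex 0 k"
      using z by (auto simp: in_segment)
    have "Im z = (1 - t) * h + t * k" using t by simp
    then have "Im z = h + t * (k - h)" by (simp add: algebra_simps)
    moreover have "0 \<le> t * (k - h)" "t * (k - h) \<le> k - h"
      using t that(2) by (simp_all add: mult_left_le_one_le)
    ultimately show ?thesis using t by simp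
  qed
  have base: "Im z = 0 \<and> -1 \<le> Re z \<and> Re z \<le> 1"
    if z: "z \<in> closed_segment (Complex (-1) 0) (Complex 1 0)" for z
  proof -
    obtain t where "0 \<le> t" "t \<le> 1" "z = (1 - t) *\<^sub>R Complex (-1) 0 + t *\<^sub>R Complex 1 0"
      using z by (auto simp: in_segment)
    then have "Re z = 2 * t - 1" "Im z = 0" "0 \<le> t" "t \<le> 1" by simp_all
    then show ?thesis by (simp add: algebra_simps)
  qed
  \<comment> \<open>Linear conditions satisfied by the points of each edge. Comparing two edges, or
    an edge and a vertex, then becomes linear arithmetic in the coordinates.\<close>
  define Q :: "nat set \<Rightarrow> complex \<Rightarrow> bool" where "Q e z \<longleftrightarrow>
     (e = {0,2} \<longrightarrow> Im z = 1 + Re z \<and> -1 \<le> Re z \<and> Re z \<le> 0) \<and>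
     (e = {2,4} \<longrightarrow> Im z = 2 + 2 * Re z \<and> -1 \<le> Re z \<and> Re z \<le> 0) \<and>
     (e = {1,2} \<longrightarrow> Im z = 3 + 3 * Re z \<and> -1 \<le> Re z \<and> Re z \<le> 0) \<and>
     (e = {0,3} \<longrightarrow> Im z = 1 - Re z \<and> 0 \<le> Re z \<and> Re z \<le> 1) \<and>
     (e = {3,4} \<longrightarrow> Im z = 2 - 2 * Re z \<and> 0 \<le> Re z \<and> Re z \<le> 1) \<and>
     (e = {1,3} \<longrightarrow> Im z = 3 - 3 * Re z \<and> 0 \<le> Re z \<and> Re z \<le> 1) \<and>
     (e = {0,4} \<longrightarrow> Re z = 0 \<and> 1 \<le> Im z \<and> Im z \<le> 2) \<and>
     (e = {1,4} \<longrightarrow> Re z = 0 \<and> 2 \<le> Im z \<and> Im z \<le> 3) \<and>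
     (e = {2,3} \<longrightarrow> Im z = 0 \<and> -1 \<le> Re z \<and> Re z \<le> 1)" for e z
  have Q: "Q e z" if "e \<in> edges K5_minus_edge" "z \<in> path_image (\<gamma> e)" for e z
    using that unfolding edges_K5_minus_edge \<gamma>_def
    by (elim insertE emptyE; simp add: p Q_def doubleton_eq_iff del: One_nat_def;
        (use left[of z 1] left[of z 2] left[of z 3] right[of z 1] right[of z 2] right[of z 3]
          axis[of z 1 2] axis[of z 2 3] base[of z] in \<open>force simp: closed_segment_commute\<close>))
  have "plane_drawing K5_minus_edge p \<gamma>"
    unfolding plane_drawing_def
  proof (intro conjI ballI impI)
    show "inj_on p (verts K5_minus_edge)"
      unfolding verts_K5_minus_edge inj_on_def by (auto simp: p_def split: if_splits)
    fix e assume e: "e \<in> edges K5_minus_edge"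
    show "arc (\<gamma> e)" "{pathstart (\<gamma> e), pathfinish (\<gamma> e)} = p ` e"
      using e unfolding edges_K5_minus_edge \<gamma>_def
      by (elim insertE emptyE; simp add: p del: One_nat_def)+
    show "path_image (\<gamma> e) \<inter> p ` verts K5_minus_edge \<subseteq> p ` e"
    proof
      fix z assume z: "z \<in> path_image (\<gamma> e) \<inter> p ` verts K5_minus_edge"
      then have "Q e z" using Q e by blast
      moreover have "verts K5_minus_edge = {0,1,2,3,4}" unfolding verts_K5_minus_edge by auto
      then have "z \<in> {p 0, p 1, p 2, p 3, p 4}" using z by auto
      ultimately show "z \<in> p ` e" using e unfolding edges_K5_minus_edge
        by (elim insertE emptyE; simp add: p Q_def doubleton_eq_iff del: One_nat_def)
    qed
    fix e' assume e': "e' \<in> edges K5_minus_edge" "e \<noteq> e'"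
    show "path_image (\<gamma> e) \<inter> path_image (\<gamma> e') \<subseteq> p ` (e \<inter> e')"
    proof
      fix z assume "z \<in> path_image (\<gamma> e) \<inter> path_image (\<gamma> e')"
      then have "Q e z" "Q e' z" using Q e e' by blast+
      then show "z \<in> p ` (e \<inter> e')" using e e' unfolding edges_K5_minus_edge
        by (elim insertE emptyE; simp add: p Q_def doubleton_eq_iff complex_eq_iff del: One_nat_def; linarith?)
    qed
  qed
  then show ?thesis by (auto simp: planar_def)
qed

text \<open>The target \<open>{0,2,3,4}\<close> omits one end of the missing edge
  \<open>{0,1}\<close>, so it spans a complete graph and every injection into it preserves
  edges.\<close>

lemma planar_card_le_4:
  assumes H: "simple_graph H" and "card (verts H) \<le> 4"
  shows "planar H"
proof -
  have "finite (verts H)" using H by (simp add: simple_graph_def)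
  then obtain f :: "'a \<Rightarrow> nat" where f: "f ` verts H \<subseteq> {0,2,3,4}" "inj_on f (verts H)"
    using card_le_inj[of "verts H" "{0,2,3,4::nat}"] assms(2) by auto
  show ?thesis
  proof (rule planar_inj_hom[OF H f(2) _ _ planar_K5_minus_edge])
    show "f ` verts H \<subseteq> verts K5_minus_edge" using f(1) by (auto simp: verts_K5_minus_edge)
    fix e assume e: "e \<in> edges H"
    then obtain u v where uv: "e = {u, v}" "u \<noteq> v" "u \<in> verts H" "v \<in> verts H"
      by (rule edge_endsE[OF H])
    then have "f u \<noteq> f v" "f u \<in> {0,2,3,4}" "f v \<in> {0,2,3,4}" using f by (auto dest: inj_onD)
    then show "f ` e \<in> edges K5_minus_edge"
      unfolding uv(1) by (auto simp: edge_K5_minus_edge doubleton_eq_iff)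
  qed
qed

text \<open>The only nonadjacent pair is the one sent to \<open>{0, 1}\<close>, so adding an edge
  there makes all five vertices mutually adjacent.\<close>

lemma CAN_K5_minus_edge:
  assumes G: "simple_graph G" and iso: "graph_iso G K5_minus_edge"
  shows "CAN G"
proof -
  obtain f where f: "bij_betw f (verts G) {..<5}"
    and edge: "\<And>u v. u \<in> verts G \<Longrightarrow> v \<in> verts G \<Longrightarrow> {u, v} \<in> edges G \<longleftrightarrow> {f u, f v} \<in> edges K5_minus_edge"
    using iso unfolding graph_iso_def verts_K5_minus_edge by blast
  have inj: "inj_on f (verts G)" and img: "f ` verts G = {..<5}" using f by (auto simp: bij_betw_def)
  have "planar G"
  proof (rule planar_inj_hom[OF G inj _ _ planar_K5_minus_edge])
    show "f ` verts G \<subseteq> verts K5_minus_edge" using img by (simp add: verts_K5_minus_edge)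
    fix e assume e: "e \<in> edges G"
    then obtain u v where uv: "e = {u, v}" "u \<in> verts G" "v \<in> verts G"
      using edge_endsE[OF G] by metis
    then show "f ` e \<in> edges K5_minus_edge" using e edge by simp
  qed
  moreover have "\<not> complete_graph G"
  proof -
    have "0 \<in> f ` verts G" "1 \<in> f ` verts G" unfolding img by auto
    then obtain u v where uv: "u \<in> verts G" "f u = 0" "v \<in> verts G" "f v = 1"
      by (metis imageE)
    moreover then have "{u, v} \<notin> edges G" using edge[of u v] edge_K5_minus_edge[of 0 1] by simp
    ultimately show ?thesis unfolding complete_graph_def by (metis zero_neq_one)
  qed
  moreover have "\<not> planar (add_edge G u v)"
    if uv: "u \<in> verts G" "v \<in> verts G" "u \<noteq> v" "{u, v} \<notin> edges G" for u v
  proof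
    have non_edge: "{f w, f z} = {0, 1}"
      if "w \<in> verts G" "z \<in> verts G" "w \<noteq> z" "{w, z} \<notin> edges G" for w z
    proof -
      have "f w \<noteq> f z" using inj_onD[OF inj] that by blast
      moreover have "f w < 5" "f z < 5" using img that by blast+
      ultimately show ?thesis
        using edge[OF that(1,2)] edge_K5_minus_edge[of "f w" "f z"] that(4) by argo
    qed
    assume "planar (add_edge G u v)"
    then obtain p \<gamma> where d: "plane_drawing (add_edge G u v) p \<gamma>" by (auto simp: planar_def)
    show False
    proof (rule no_plane_drawing_K5[OF d])
      show "verts G \<subseteq> verts (add_edge G u v)" by (simp add: add_edge_def)
      show "card (verts G) = 5" using bij_betw_same_card[OF f] by simp
      fix w z assume wz: "w \<in> verts G" "z \<in> verts G" "w \<noteq> z"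
      show "{w, z} \<in> edges (add_edge G u v)"
      proof (cases "{w, z} \<in> edges G")
        case False
        then have "f ` {w, z} = f ` {u, v}" using non_edge[OF wz] non_edge[OF uv] by simp
        then have "{w, z} = {u, v}" using inj_on_image_eq_iff[OF inj] wz uv by (metis empty_subsetI insert_subset)
        then show ?thesis by (simp add: add_edge_def)
      qed (simp add: add_edge_def)
    qed
  qed
  ultimately show ?thesis by (auto simp: CAN_def)
qed

text \<open>Each contraction loses a vertex, so an unchanged number of vertices means that nothing
  was contracted. This reduces five-vertex minors to spanning subgraphs.\<close>

lemma contracts_to_simple:
  assumes "contracts_to S K" "simple_graph S"
  shows "simple_graph K \<and> card (verts K) \<le> card (verts S) \<and> (card (verts K) = card (verts S) \<longrightarrow> K = S)"
  using assms
proof induction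
  case (step S H u v)
  then have H: "simple_graph H" and le: "card (verts H) \<le> card (verts S)" by auto
  have uv: "u \<in> verts H" "v \<in> verts H" using H step.hyps(2) by (auto simp: simple_graph_def)
  have "e \<subseteq> verts H" if "e \<in> edges H" for e using H that by (auto simp: simple_graph_def)
  then have "simple_graph (contract H u v)"
    using H uv step.hyps(3) unfolding simple_graph_def contract_def by fastforce
  moreover have "card (verts (contract H u v)) < card (verts H)"
    using H uv unfolding contract_def simple_graph_def by (simp add: card_Diff1_less del: card_Diff_insert)
  ultimately show ?case using le by auto
qed auto

lemma proper_minor_K5_minus_edge_not_CAN:
  fixes G :: "'a graph" and H :: "'b graph"
  assumes G: "simple_graph G" and iso: "graph_iso G K5_minus_edge" and H: "proper_minor H G"
  shows "\<not> CAN H"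
proof
  assume can: "CAN H"
  have cardG: "card (verts G) = 5"
    using iso bij_betw_same_card unfolding graph_iso_def verts_K5_minus_edge by fastforce
  obtain S K where HK: "simple_graph H" "subgraph S G" "contracts_to S K" "graph_iso H K" "\<not> graph_iso H G"
    using H by (auto simp: proper_minor_def minor_def)
  have S: "simple_graph S" "verts S \<subseteq> verts G" "edges S \<subseteq> edges G" using HK by (auto simp: subgraph_def)
  have finG: "finite (verts G)" using G by (simp add: simple_graph_def)
  obtain f where f: "bij_betw f (verts H) (verts K)"
    and edge: "\<And>u v. u \<in> verts H \<Longrightarrow> v \<in> verts H \<Longrightarrow> {u, v} \<in> edges H \<longleftrightarrow> {f u, f v} \<in> edges K"
    using HK unfolding graph_iso_def by blast
  note K = contracts_to_simple[OF HK(3) S(1)]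
  have SG: "card (verts S) \<le> card (verts G)" using S finG card_mono by blast
  have add: "simple_graph (add_edge H u v)" if "u \<in> verts H" "v \<in> verts H" "u \<noteq> v" for u v
    using HK(1) that by (auto simp: simple_graph_def add_edge_def)
  obtain u v where uv: "u \<in> verts H" "v \<in> verts H" "u \<noteq> v" "{u, v} \<notin> edges H"
    and pl: "planar (add_edge H u v)"
  proof (cases "card (verts H) \<le> 4")
    case True
    obtain u v where uv: "u \<in> verts H" "v \<in> verts H" "u \<noteq> v" "{u, v} \<notin> edges H"
      using can by (auto simp: CAN_def complete_graph_def)
    moreover have "planar (add_edge H u v)"
      using planar_card_le_4[OF add[OF uv(1-3)]] True by (simp add: add_edge_def)
    ultimately show ?thesis using that by blast
  next
    case False
    then have "card (verts K) = card (verts S)" "card (verts S) = card (verts G)"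
      using bij_betw_same_card[OF f] K SG cardG by auto
    then have KS: "K = S" and verts: "verts K = verts G" using K S card_subset_eq[OF finG] by auto
    \<comment> \<open>Here properness enters: equal edge sets would give \<open>K = G\<close>,
      making \<open>H\<close> isomorphic to \<open>G\<close>.\<close>
    have "edges K \<noteq> edges G" using HK(4,5) verts by (metis graph.expand)
    then obtain e where e: "e \<in> edges G" "e \<notin> edges K" using S KS by blast
    then obtain a b where ab: "e = {a, b}" "a \<noteq> b" "a \<in> verts G" "b \<in> verts G"
      using edge_endsE[OF G] by metis
    then obtain u v where uv: "u \<in> verts H" "v \<in> verts H" "f u = a" "f v = b"
      using f verts unfolding bij_betw_def by (metis imageE)
    have uv': "u \<noteq> v" "{u, v} \<notin> edges H" using uv ab e edge by auto
    have "planar (add_edge H u v)"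
    proof (rule planar_inj_hom[OF add[OF uv(1,2) uv'(1)]])
      show "inj_on f (verts (add_edge H u v))" "f ` verts (add_edge H u v) \<subseteq> verts G"
        using f verts by (auto simp: add_edge_def bij_betw_def)
      show "planar G" using CAN_K5_minus_edge[OF G iso] by (simp add: CAN_def)
      fix e' assume "e' \<in> edges (add_edge H u v)"
      then consider "e' = {u, v}" | "e' \<in> edges H" by (auto simp: add_edge_def)
      then show "f ` e' \<in> edges G"
      proof cases
        case 1 then show ?thesis using uv ab e by simp
      next
        case 2
        then obtain w z where wz: "e' = {w, z}" "w \<in> verts H" "z \<in> verts H"
          using edge_endsE[OF HK(1)] by metis
        then show ?thesis using edge 2 S KS by auto
      qed
    qed
    then show ?thesis using that uv uv' by blast
  qed
  then show False using can by (auto simp: CAN_def)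
qed

subsection \<open>Finding \<open>K\<^sub>5 - e\<close> as a minor\<close>

text \<open>Connected sets containing \<open>b\<close>, presented in an order of absorption: each
  step supplies the edge used for the next contraction, and \<open>b\<close> is the label that
  survives.\<close>

inductive grows :: "'a graph \<Rightarrow> 'a \<Rightarrow> 'a set \<Rightarrow> bool" for G b where
  grows_single: "grows G b {b}"
| grows_insert: "grows G b B \<Longrightarrow> u \<in> B \<Longrightarrow> v \<notin> B \<Longrightarrow> {u, v} \<in> edges G \<Longrightarrow> grows G b (insert v B)"

lemma grows_root: "grows G b B \<Longrightarrow> b \<in> B"
  by (induction rule: grows.induct) auto

text \<open>Only edges inside \<open>B\<close> matter, so growth persists in an induced subgraph and
  after a set disjoint from \<open>B\<close> has been contracted.\<close>

lemma grows_transfer: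
  assumes "grows G b B"
    and "\<And>u v. u \<in> B \<Longrightarrow> v \<in> B \<Longrightarrow> {u, v} \<in> edges G \<Longrightarrow> {u, v} \<in> edges H"
  shows "grows H b B"
  using assms by (induction rule: grows.induct) (auto intro!: grows_single grows_insert)

lemma grows_path:
  assumes "successively (\<lambda>u v. {u, v} \<in> edges G) (v # us)" "distinct (v # us)"
  shows "grows G v (set (v # us))"
  using assms
proof (induction us rule: rev_induct)
  case Nil
  then show ?case by (simp add: grows_single)
next
  case (snoc w us)
  have "successively (\<lambda>u v. {u, v} \<in> edges G) (v # us)" "{last (v # us), w} \<in> edges G"
    using snoc.prems(1) successively_append_iff[of _ "v # us" "[w]"] by auto
  moreover from this have "grows G v (set (v # us))" using snoc by simp
  ultimately have "grows G v (insert w (set (v # us)))"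
    using snoc.prems(2) by (intro grows_insert[of _ _ _ "last (v # us)"]) auto
  then show ?case by (simp add: insert_commute)
qed

text \<open>A closed form for successive contractions onto \<open>b\<close>, modelled on
  \<open>contract\<close>. Adjacency in the result can be read off without following the
  sequence.\<close>

definition merge :: "'a graph \<Rightarrow> 'a set \<Rightarrow> 'a \<Rightarrow> 'a graph" where
  "merge G B b = Graph (verts G - (B - {b}))
     {e'. card e' = 2 \<and> (\<exists>e\<in>edges G. e' = (\<lambda>x. if x \<in> B then b else x) ` e)}"

lemma merge_single:
  assumes "simple_graph G"
  shows "merge G {b} b = G"
proof -
  have "(\<lambda>x. if x \<in> {b} then b else x) = id" by auto
  then show ?thesis unfolding merge_def using assms by (intro graph.expand) (auto simp: simple_graph_def)
qed

lemma contract_merge: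
  assumes G: "simple_graph G" and "b \<in> B" "v \<notin> B"
  shows "contract (merge G B b) b v = merge G (insert v B) b"
proof -
  let ?f = "\<lambda>x. if x \<in> B then b else x" and ?g = "\<lambda>x. if x = v then b else x"
  let ?h = "\<lambda>x. if x \<in> insert v B then b else x"
  have comp: "?g ` ?f ` e = ?h ` e" for e using assms(2,3) by (auto simp: image_image intro!: image_cong)
  \<comment> \<open>An edge collapsed by the first merging would already be dropped. This cannot
    happen to an edge that survives both maps, since the second map does not increase
    cardinality.\<close>
  have card: "card (?f ` e) = 2" if "e \<in> edges G" "card (?h ` e) = 2" for e
  proof -
    have e: "finite e" "card e = 2" using G that by (auto simp: simple_graph_def intro: card_ge_0_finite)
    have "card (?f ` e) \<le> 2" using card_image_le[OF e(1), of ?f] e(2) by simp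
    moreover have "2 \<le> card (?f ` e)" using card_image_le[of "?f ` e" ?g] e(1) that(2) unfolding comp by simp
    ultimately show ?thesis by simp
  qed
  have "{e''. card e'' = 2 \<and> (\<exists>e'\<in>{e'. card e' = 2 \<and> (\<exists>e\<in>edges G. e' = ?f ` e)}. e'' = ?g ` e')}
      = {e''. card e'' = 2 \<and> (\<exists>e\<in>edges G. e'' = ?h ` e)}"
  proof (intro Collect_cong conj_cong[OF HOL.refl])
    fix e'' :: "'a set" assume c: "card e'' = 2"
    show "(\<exists>e'\<in>{e'. card e' = 2 \<and> (\<exists>e\<in>edges G. e' = ?f ` e)}. e'' = ?g ` e') \<longleftrightarrow> (\<exists>e\<in>edges G. e'' = ?h ` e)"
      (is "?L \<longleftrightarrow> ?R")
    proof
      assume ?L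
      then obtain e where "e \<in> edges G" "e'' = ?g ` ?f ` e" by blast
      then show ?R unfolding comp by blast
    next
      assume ?R
      then obtain e where e: "e \<in> edges G" "e'' = ?h ` e" by blast
      then have "card (?f ` e) = 2" "e'' = ?g ` ?f ` e" using card c unfolding comp by simp_all
      then show ?L using e(1) by blast
    qed
  qed
  moreover have "verts G - (B - {b}) - {v} = verts G - (insert v B - {b})" using assms by auto
  ultimately show ?thesis by (simp add: contract_def merge_def)
qed

text \<open>An edge \<open>{u, v}\<close> leaving \<open>B\<close> turns into \<open>{b, v}\<close>
  once \<open>B\<close> is merged, and that is the edge to contract next.\<close>

lemma contracts_to_merge:
  assumes "grows G b B" "simple_graph G"
  shows "contracts_to G (merge G B b)"
  using assms
proof (induction rule: grows.induct)
  case grows_single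
  then show ?case by (simp add: merge_single contracts_to.refl)
next
  case (grows_insert B u v)
  have b: "b \<in> B" by (rule grows_root[OF grows_insert.hyps(1)])
  have "{b, v} = (\<lambda>x. if x \<in> B then b else x) ` {u, v}" using grows_insert.hyps by auto
  moreover have "b \<noteq> v" using b grows_insert.hyps by auto
  ultimately have "{b, v} \<in> edges (merge G B b)"
    unfolding merge_def graph.sel using grows_insert.hyps(4) by (auto simp: card_2_iff)
  then have "contracts_to G (contract (merge G B b) b v)"
    using grows_insert \<open>b \<noteq> v\<close> by (intro contracts_to.step) auto
  then show ?case using contract_merge[OF grows_insert.prems b grows_insert.hyps(3)] by simp
qed

lemma contracts_to_trans:
  assumes "contracts_to H K" "contracts_to G H"
  shows "contracts_to G K"
  using assms by (induction rule: contracts_to.induct) (auto intro: contracts_to.step)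

text \<open>A surviving label stands for its fibre under the merging map, and adjacency of labels is
  the existence of an edge between fibres.\<close>

lemma edge_merge:
  assumes G: "simple_graph G" and b: "b \<in> B" and s: "s = b \<or> s \<notin> B" and t: "t = b \<or> t \<notin> B" and st: "s \<noteq> t"
  shows "{s, t} \<in> edges (merge G B b) \<longleftrightarrow>
     (\<exists>s'\<in>(if s = b then B else {s}). \<exists>t'\<in>(if t = b then B else {t}). {s', t'} \<in> edges G)"
    (is "?L \<longleftrightarrow> ?R")
proof
  let ?f = "\<lambda>x. if x \<in> B then b else x"
  have fib: "a \<in> (if ?f a = b then B else {?f a})" for a using b by auto
  assume ?L
  then obtain e where e: "e \<in> edges G" "{s, t} = ?f ` e" by (auto simp: merge_def)
  obtain a c where ac: "e = {a, c}" by (rule edge_endsE[OF G e(1)])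
  then have "{s, t} = {?f a, ?f c}" using e(2) by simp
  then consider "s = ?f a" "t = ?f c" | "s = ?f c" "t = ?f a" by (auto simp only: doubleton_eq_iff)
  then show ?R
  proof cases
    case 1
    show ?thesis unfolding 1 using e(1) ac by (intro bexI[OF _ fib] bexI[OF _ fib]) simp
  next
    case 2
    show ?thesis unfolding 2 using e(1) ac by (intro bexI[OF _ fib] bexI[OF _ fib]) (simp add: insert_commute)
  qed
next
  assume ?R
  then obtain s' t' where e: "{s', t'} \<in> edges G"
    and st': "s' \<in> (if s = b then B else {s})" "t' \<in> (if t = b then B else {t})" by blast
  have "(if s' \<in> B then b else s') = s" "(if t' \<in> B then b else t') = t"
    using st' s t by (auto split: if_splits)
  then have "{s, t} = (\<lambda>x. if x \<in> B then b else x) ` {s', t'}"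
    by (simp only: image_insert image_empty)
  moreover have "card {s, t} = 2" using st by simp
  ultimately show ?L using e unfolding merge_def by auto
qed

text \<open>\<open>P\<close> is the vertex set of a path from \<open>v\<^sub>1\<close> to a
  neighbour of \<open>c\<close>, which closes to a cycle through \<open>c\<close> and
  \<open>v\<^sub>0\<close>. Contracting \<open>P\<close> to \<open>v\<^sub>1\<close> leaves the
  triangle on \<open>v\<^sub>0\<close>, \<open>v\<^sub>1\<close>, \<open>c\<close>.\<close>

lemma min_degree_two_triangle:
  assumes G: "simple_graph G" and T: "finite T" "T \<noteq> {}" "min_degree_two G T"
  obtains v\<^sub>0 v\<^sub>1 c P where "grows G v\<^sub>1 P" "P \<subseteq> T" "v\<^sub>0 \<in> T - P" "c \<in> T - P" "v\<^sub>0 \<noteq> c"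
    "{v\<^sub>0, v\<^sub>1} \<in> edges G" "{v\<^sub>0, c} \<in> edges G" "\<exists>w\<in>P. {w, c} \<in> edges G"
proof -
  (* The first vertex of a longest path has a second neighbour c on that path. *)
  define path where "path xs \<longleftrightarrow> xs \<noteq> [] \<and> distinct xs \<and> set xs \<subseteq> T \<and>
    successively (\<lambda>u v. {u, v} \<in> edges G) xs" for xs
  obtain t where "t \<in> T" using T by blast
  then have "path [t]" by (simp add: path_def)
  moreover have "\<forall>xs. path xs \<longrightarrow> length xs < Suc (card T)"
    using T(1) by (auto simp: path_def less_Suc_eq_le intro: card_mono dest!: distinct_card[symmetric])
  ultimately obtain xs where xs: "path xs" "\<And>ys. path ys \<Longrightarrow> length ys \<le> length xs"
    using ex_has_greatest_nat[of path "[t]" length] by blast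
  then obtain v\<^sub>0 ws where v0: "xs = v\<^sub>0 # ws" by (auto simp: path_def neq_Nil_conv)
  \<comment> \<open>A neighbour off the path would extend it at the front.\<close>
  have nbr: "a \<in> set ws" if "a \<in> T" "{v\<^sub>0, a} \<in> edges G" for a
  proof (rule ccontr)
    assume "a \<notin> set ws"
    moreover have "a \<noteq> v\<^sub>0" using edge_vertices[OF G that(2)] by auto
    ultimately have "path (a # xs)" using xs(1) that v0 by (auto simp: path_def insert_commute)
    then show False using xs(2) by fastforce
  qed
  have "v\<^sub>0 \<in> T" using xs(1) v0 by (auto simp: path_def)
  then obtain a b where ab: "a \<in> T" "b \<in> T" "a \<noteq> b" "{v\<^sub>0, a} \<in> edges G" "{v\<^sub>0, b} \<in> edges G"
    using T(3) unfolding min_degree_two_def by blast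
  then have "a \<in> set ws" "b \<in> set ws" using nbr by auto
  then obtain v\<^sub>1 ws' where v1: "ws = v\<^sub>1 # ws'" by (cases ws) auto
  then obtain c where c: "c \<in> set ws'" "{v\<^sub>0, c} \<in> edges G"
    using ab \<open>a \<in> set ws\<close> \<open>b \<in> set ws\<close> by auto
  then obtain us zs where us: "ws' = us @ c # zs" by (meson split_list)
  have p: "distinct (v\<^sub>0 # v\<^sub>1 # us @ c # zs)" "set (v\<^sub>0 # v\<^sub>1 # us @ c # zs) \<subseteq> T"
    "successively (\<lambda>u v. {u, v} \<in> edges G) (v\<^sub>0 # (v\<^sub>1 # us) @ (c # zs))"
    using xs(1) unfolding path_def v0 v1 us by auto
  have s: "{v\<^sub>0, v\<^sub>1} \<in> edges G" "successively (\<lambda>u v. {u, v} \<in> edges G) ((v\<^sub>1 # us) @ (c # zs))"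
    using p(3) by auto
  then have "successively (\<lambda>u v. {u, v} \<in> edges G) (v\<^sub>1 # us)" "{last (v\<^sub>1 # us), c} \<in> edges G"
    unfolding successively_append_iff by auto
  moreover have "last (v\<^sub>1 # us) \<in> set (v\<^sub>1 # us)" by (rule last_in_set) simp
  ultimately show ?thesis
    using that[of v\<^sub>1 "set (v\<^sub>1 # us)" v\<^sub>0 c] grows_path[of G v\<^sub>1 us] p(1,2) s(1) c(2) by auto
qed

lemma graph_iso_K5_minus_edgeI:
  assumes K: "simple_graph K" and V: "verts K = {a, b, c, d, e}" and dist: "distinct [a, b, c, d, e]"
    and edge: "\<And>u v. u \<in> verts K \<Longrightarrow> v \<in> verts K \<Longrightarrow> u \<noteq> v \<Longrightarrow> {u, v} \<in> edges K \<longleftrightarrow> {u, v} \<noteq> {a, b}"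
  shows "graph_iso K K5_minus_edge"
proof -
  define f where "f v = (if v = a then 0 else if v = b then 1 else if v = c then 2 else if v = d then 3 else 4 :: nat)" for v
  have f: "f a = 0" "f b = 1" "f c = 2" "f d = 3" "f e = 4" using dist by (auto simp: f_def)
  have inj: "inj_on f (verts K)" unfolding V inj_on_def using f by auto
  have five: "{..<5} = {0, 1, 2, 3, 4::nat}" by auto
  have "f ` verts K = {..<5}" unfolding V five using f by simp
  then have bij: "bij_betw f (verts K) (verts K5_minus_edge)"
    using inj by (simp add: bij_betw_def verts_K5_minus_edge)
  have "{u, v} \<in> edges K \<longleftrightarrow> {f u, f v} \<in> edges K5_minus_edge" if uv: "u \<in> verts K" "v \<in> verts K" for u v
  proof (cases "u = v")
    case True
    then show ?thesis using edge_vertices(1)[OF K, of u v] edge_vertices(1)[OF simple_K5_minus_edge, of "f u" "f v"] by auto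
  next
    case False
    have "{a, b} \<subseteq> verts K" using V by auto
    then have "{f u, f v} = {0, 1} \<longleftrightarrow> {u, v} = {a, b}"
      using inj_on_image_eq_iff[OF inj, of "{u, v}" "{a, b}"] f uv by simp
    moreover have "f u < 5" "f v < 5" using \<open>f ` verts K = {..<5}\<close> uv by auto
    moreover have "f u \<noteq> f v" using inj_onD[OF inj] uv False by blast
    ultimately show ?thesis using edge[OF uv False] edge_K5_minus_edge[of "f u" "f v"] by argo
  qed
  then show ?thesis unfolding graph_iso_def using bij by blast
qed

lemma CAN_has_K5_minus_edge_minor:
  fixes G :: "'a graph"
  assumes G: "simple_graph G" and can: "CAN G"
  obtains K :: "'a graph" where "minor K G" "simple_graph K" "graph_iso K K5_minus_edge"
proof -
  obtain x y where xy: "x \<in> verts G" "y \<in> verts G" "x \<noteq> y" "{x, y} \<notin> edges G"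
    using can by (auto simp: CAN_def complete_graph_def)
  have fin: "finite (verts G)" using G by (simp add: simple_graph_def)
  define U where "U = {w \<in> verts G. w \<noteq> x \<and> {x, w} \<notin> edges G}"
  \<comment> \<open>A maximal member is the component of \<open>y\<close> in the graph induced on
    the non-neighbours of \<open>x\<close>.\<close>
  let ?\<D> = "{B. grows G y B \<and> B \<subseteq> U}"
  have "finite ?\<D>" using fin by (intro finite_subset[of ?\<D> "Pow (verts G)"]) (auto simp: U_def)
  moreover have "{y} \<in> ?\<D>" using xy by (auto simp: U_def grows_single)
  then have "?\<D> \<noteq> {}" by blast
  ultimately have "\<exists>D\<in>?\<D>. \<forall>B\<in>?\<D>. D \<subseteq> B \<longrightarrow> D = B" by (rule finite_has_maximal)
  then obtain D where "D \<in> ?\<D>" and maximal: "\<forall>B\<in>?\<D>. D \<subseteq> B \<longrightarrow> D = B" ..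
  then have D: "grows G y D" "D \<subseteq> U" by auto
  have max: "B = D" if "grows G y B" "B \<subseteq> U" "D \<subseteq> B" for B using maximal that by auto
  have yD: "y \<in> D" by (rule grows_root[OF D(1)])
  define N where "N = {w \<in> verts G - D. \<exists>u\<in>D. {u, w} \<in> edges G}"
  have Nx: "{x, w} \<in> edges G" if "w \<in> N" for w
  proof -
    obtain u where u: "u \<in> D" "{u, w} \<in> edges G" "w \<in> verts G" "w \<notin> D"
      using \<open>w \<in> N\<close> by (auto simp: N_def)
    have "w \<notin> U"
    proof
      assume "w \<in> U"
      then have "insert w D \<subseteq> U" using D(2) by simp
      then have "insert w D = D" using max[OF grows_insert[OF D(1) u(1,4,2)]] by auto
      then show False using u by blast
    qed
    moreover have "w \<noteq> x" using u D(2) by (auto simp: U_def insert_commute)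
    ultimately show ?thesis using u by (simp add: U_def)
  qed
  have xDN: "x \<notin> D" "x \<notin> N" using D(2) Nx edge_vertices(1)[OF G] by (auto simp: U_def)
  have DV: "D \<subseteq> verts G" using D(2) by (auto simp: U_def)
  \<comment> \<open>The set \<open>N\<close> is a genuine separator: \<open>y\<close> lies in
    \<open>D\<close>, and \<open>x\<close> lies outside both \<open>D\<close> and
    \<open>N\<close>.\<close>
  have "\<exists>T\<subseteq>N. T \<noteq> {} \<and> min_degree_two G T"
  proof (rule CAN_separator_contains_cycle[OF G can, of D N "verts G - D - N"])
    show "verts G = D \<union> N \<union> (verts G - D - N)" using DV by (auto simp: N_def)
    show "D \<inter> N = {}" by (auto simp: N_def)
    fix e assume e: "e \<in> edges G"
    obtain u v where uv: "e = {u, v}" "u \<in> verts G" "v \<in> verts G" by (rule edge_endsE[OF G e])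
    then have "v \<in> D \<union> N" if "u \<in> D" using that e by (auto simp: N_def)
    moreover have "u \<in> D \<union> N" if "v \<in> D" using that e uv by (auto simp: N_def insert_commute)
    ultimately show "e \<inter> D = {} \<or> e \<inter> (verts G - D - N) = {}" using uv by auto
  qed (use xDN xy yD in auto)
  then obtain T where T: "T \<subseteq> N" "T \<noteq> {}" "min_degree_two G T" by blast
  have TV: "T \<subseteq> verts G" "T \<inter> D = {}" using T by (auto simp: N_def)
  obtain v\<^sub>0 v\<^sub>1 c P where P: "grows G v\<^sub>1 P" "P \<subseteq> T" "v\<^sub>0 \<in> T - P" "c \<in> T - P" "v\<^sub>0 \<noteq> c"
    "{v\<^sub>0, v\<^sub>1} \<in> edges G" "{v\<^sub>0, c} \<in> edges G" "\<exists>w\<in>P. {w, c} \<in> edges G"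
    by (rule min_degree_two_triangle[OF G finite_subset[OF TV(1) fin] T(2,3)])
  have v1P: "v\<^sub>1 \<in> P" by (rule grows_root[OF P(1)])
  \<comment> \<open>Exactly the vertices that leave five labels once \<open>D\<close> and
    \<open>P\<close> are merged.\<close>
  define W where "W = {x, v\<^sub>0, c} \<union> D \<union> P"
  have WV: "W \<subseteq> verts G" using xy P TV DV by (auto simp: W_def)
  have S: "subgraph (induced G W) G" and sS: "simple_graph (induced G W)"
    using G WV finite_subset[OF WV fin] by (auto simp: subgraph_def induced_def simple_graph_def)
  have edgeS: "{u, v} \<in> edges (induced G W) \<longleftrightarrow> {u, v} \<in> edges G" if "u \<in> W" "v \<in> W" for u v
    using that by (simp add: induced_def)
  let ?M = "merge (induced G W) D y"
  have "grows (induced G W) y D"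
    by (rule grows_transfer[OF D(1)]) (use edgeS in \<open>auto simp: W_def\<close>)
  then have M: "contracts_to (induced G W) ?M" by (rule contracts_to_merge[OF _ sS])
  then have sM: "simple_graph ?M" using contracts_to_simple sS by blast
  have PD: "P \<inter> D = {}" "v\<^sub>0 \<notin> D" "c \<notin> D" "x \<notin> P" "x \<noteq> v\<^sub>0" "x \<noteq> c" using P T TV xDN by auto
  have edgeM: "{s, t} \<in> edges ?M \<longleftrightarrow>
      (\<exists>s'\<in>(if s = y then D else {s}). \<exists>t'\<in>(if t = y then D else {t}). {s', t'} \<in> edges G)"
    if "s = y \<or> s \<in> W - D" "t = y \<or> t \<in> W - D" "s \<noteq> t" for s t
  proof -
    have "{s', t'} \<in> edges (induced G W) \<longleftrightarrow> {s', t'} \<in> edges G"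
      if "s' \<in> (if s = y then D else {s})" "t' \<in> (if t = y then D else {t})" for s' t'
      using that \<open>s = y \<or> _\<close> \<open>t = y \<or> _\<close> by (intro edgeS) (auto simp: W_def split: if_splits)
    then show ?thesis using edge_merge[OF sS yD, of s t] that by blast
  qed
  let ?K = "merge ?M P v\<^sub>1"
  have "grows ?M v\<^sub>1 P"
  proof (rule grows_transfer[OF P(1)])
    fix u v assume uv: "u \<in> P" "v \<in> P" "{u, v} \<in> edges G"
    then have "u \<noteq> v" using edge_vertices(1)[OF G] by blast
    moreover have "u \<in> W - D" "v \<in> W - D" "u \<noteq> y" "v \<noteq> y" using uv PD yD by (auto simp: W_def)
    ultimately show "{u, v} \<in> edges ?M" using edgeM[of u v] uv(3) by simp
  qed
  then have K: "contracts_to ?M ?K" by (rule contracts_to_merge[OF _ sM])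
  then have sK: "simple_graph ?K" using contracts_to_simple sM by blast
  have VK: "verts ?K = {x, y, v\<^sub>0, v\<^sub>1, c}"
    using PD P(3,4) yD v1P xDN by (auto simp: merge_def induced_def W_def)
  have dist: "distinct [x, y, v\<^sub>0, v\<^sub>1, c]" using PD P(3,4,5) yD v1P xDN by auto
  \<comment> \<open>The set of original vertices represented by each label after both
    mergings.\<close>
  define bag where "bag s = (if s = y then D else if s = v\<^sub>1 then P else {s})" for s
  have edgeK: "{s, t} \<in> edges ?K \<longleftrightarrow> (\<exists>s'\<in>bag s. \<exists>t'\<in>bag t. {s', t'} \<in> edges G)"
    if st: "s \<in> verts ?K" "t \<in> verts ?K" "s \<noteq> t" for s t
  proof -
    have sP: "r = v\<^sub>1 \<or> r \<notin> P" if "r \<in> verts ?K" for r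
      using that PD P(3,4) yD unfolding VK by auto
    let ?F = "\<lambda>r. if r = v\<^sub>1 then P else {r}" and ?H = "\<lambda>r. if r = y then D else {r}"
    have in_M: "r' = y \<or> r' \<in> W - D" if "r' \<in> ?F r" "r \<in> verts ?K" for r r'
      using that PD xDN unfolding VK by (auto simp: W_def split: if_splits)
    have disj: "s' \<noteq> t'" if "s' \<in> ?F s" "t' \<in> ?F t" for s' t'
      using that sP[OF st(1)] sP[OF st(2)] st(3) by (auto split: if_splits)
    \<comment> \<open>The fibres of the two mergings compose to a bag because \<open>P\<close> and
      \<open>D\<close> are disjoint: no vertex of \<open>P\<close> is expanded a second
      time.\<close>
    have bagF: "(\<exists>r'\<in>?F r. \<exists>r''\<in>?H r'. Q r'') \<longleftrightarrow> (\<exists>r''\<in>bag r. Q r'')" for r Q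
      using PD yD v1P unfolding bag_def by (auto split: if_splits)
    have "{s, t} \<in> edges ?K \<longleftrightarrow> (\<exists>s'\<in>?F s. \<exists>t'\<in>?F t. {s', t'} \<in> edges ?M)"
      using edge_merge[OF sM v1P sP[OF st(1)] sP[OF st(2)] st(3)] .
    also have "\<dots> \<longleftrightarrow> (\<exists>s'\<in>?F s. \<exists>t'\<in>?F t. \<exists>s''\<in>?H s'. \<exists>t''\<in>?H t'. {s'', t''} \<in> edges G)"
      using edgeM[OF in_M in_M disj] st by (intro bex_cong HOL.refl) blast
    also have "\<dots> \<longleftrightarrow> (\<exists>s'\<in>?F s. \<exists>s''\<in>?H s'. \<exists>t'\<in>?F t. \<exists>t''\<in>?H t'. {s'', t''} \<in> edges G)" by blast
    also have "\<dots> \<longleftrightarrow> (\<exists>s''\<in>bag s. \<exists>t''\<in>bag t. {s'', t''} \<in> edges G)"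
      unfolding bagF ..
    finally show ?thesis .
  qed
  have bags: "bag x = {x}" "bag y = D" "bag v\<^sub>0 = {v\<^sub>0}" "bag v\<^sub>1 = P" "bag c = {c}"
    using dist by (auto simp: bag_def)
  have touch: "\<exists>u\<in>D. {u, w} \<in> edges G" if "w \<in> T" for w using that T(1) by (auto simp: N_def)
  have xT: "{x, w} \<in> edges G" if "w \<in> T" for w using that T(1) Nx by auto
  have inT: "v\<^sub>0 \<in> T" "c \<in> T" "v\<^sub>1 \<in> T" using P v1P by auto
  have iK: "x \<in> verts ?K" "y \<in> verts ?K" "v\<^sub>0 \<in> verts ?K" "v\<^sub>1 \<in> verts ?K" "c \<in> verts ?K"
    unfolding VK by auto
  have adj: "{x, v\<^sub>0} \<in> edges ?K" "{x, v\<^sub>1} \<in> edges ?K" "{x, c} \<in> edges ?K" "{y, v\<^sub>0} \<in> edges ?K"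
    "{y, v\<^sub>1} \<in> edges ?K" "{y, c} \<in> edges ?K" "{v\<^sub>0, v\<^sub>1} \<in> edges ?K" "{v\<^sub>0, c} \<in> edges ?K" "{v\<^sub>1, c} \<in> edges ?K"
    using dist iK xT inT touch P(6-8) v1P by (subst edgeK; force simp: bags)+
  \<comment> \<open>All of \<open>D\<close> lies in \<open>U\<close>, so \<open>x\<close> has no
    edge into the bag of \<open>y\<close>.\<close>
  have non: "{x, y} \<notin> edges ?K"
    using xy(3) iK D(2) by (subst edgeK) (auto simp: bags U_def)
  have "graph_iso ?K K5_minus_edge"
  proof (rule graph_iso_K5_minus_edgeI[OF sK VK dist])
    fix u v assume "u \<in> verts ?K" "v \<in> verts ?K" "u \<noteq> v"
    then show "{u, v} \<in> edges ?K \<longleftrightarrow> {u, v} \<noteq> {x, y}"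
      using adj non dist unfolding VK by (elim insertE emptyE) (auto simp: insert_commute doubleton_eq_iff)
  qed
  moreover have "graph_iso ?K ?K" unfolding graph_iso_def by (intro exI[of _ id]) auto
  then have "minor ?K G"
    unfolding minor_def using sK S contracts_to_trans[OF K M] by blast
  ultimately show ?thesis using that sK by blast
qed

theorem corollary2p3:
  fixes G :: "'a graph"
  assumes "simple_graph G"
  shows "MMCAN G \<longleftrightarrow> graph_iso G K5_minus_edge"
proof
  assume G: "MMCAN G"
  then have "CAN G" by (simp add: MMCAN_def)
  then obtain K :: "'a graph" where K: "minor K G" "simple_graph K" "graph_iso K K5_minus_edge"
    by (rule CAN_has_K5_minus_edge_minor[OF assms])
  \<comment> \<open>The minor \<open>K\<close> is itself CAN, so minimality of \<open>G\<close>
    prevents it from being proper.\<close>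
  then have "graph_iso K G"
    using G CAN_K5_minus_edge unfolding MMCAN_def proper_minor_def by blast
  then show "graph_iso G K5_minus_edge" using K(3) graph_iso_sym graph_iso_trans by blast
next
  assume "graph_iso G K5_minus_edge"
  then show "MMCAN G"
    using CAN_K5_minus_edge proper_minor_K5_minus_edge_not_CAN assms unfolding MMCAN_def by blast
qed

end
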